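(* Let $d\in\mathbb{N}$, let $\mathcal{I}$ be a countably infinite index set with a $d$-regular partition $\mathscr{P}=(\mathcal{I}_m)_{m\in\mathbb{N}}$. Let $p,q\in(0,\infty]$ and $\alpha\in\mathbb{R}$ with $\alpha>d\cdot(\frac12-\frac1p)_+$. Then $\mathcal{S}:=\mathcal{B}(0,1;\ell^{p,q}_\alpha(\mathscr{P}))\subset\ell^2(\mathcal{I})$ is compact (hence Borel measurable), its optimal compression rate is $s^\ast_{\ell^2(\mathcal{I})}(\mathcal{S})=\frac{\alpha}{d}-(\frac12-\frac1p)$, and there exists a Borel probability measure on $\mathcal{S}$ that is critical for $\mathcal{S}$ with respect to $\ell^2(\mathcal{I})$.
   Context: A partition $\mathscr{P}=(\mathcal{I}_m)_{m\in\mathbb{N}}$ of a countably infinite set $\mathcal{I}$ (disjoint union $\mathcal{I}=\biguplus_m\mathcal{I}_m$) is $d$-regular if there are $0<a<A<\infty$ with $a2^{dm}\le|\mathcal{I}_m|\le A2^{dm}$ for all $m\in\mathbb{N}$. For $\mathbf{x}\in\mathbb{R}^{\mathcal{I}}$ let $\mathbf{x}_m=(x_i)_{i\in\mathcal{I}_m}$ and $\|\mathbf{x}\|_{\ell^{p,q}_\alpha(\mathscr{P})}=\|(2^{\alpha m}\|\mathbf{x}_m\|_{\ell^p(\mathcal{I}_m)})_{m\in\mathbb{N}}\|_{\ell^q(\mathbb{N})}$; $\ell^{p,q}_\alpha(\mathscr{P})$ is the set of real sequences with finite quasi-norm, and $\mathcal{B}(0,1;\cdot)$ its closed unit ball. Rate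 distortion notions for a Banach space $\mathbf{X}$ and $\mathcal{S}\subset\mathbf{X}$: a codec is a sequence $((E_R,D_R))_{R}$, $E_R:\mathcal{S}\to\{0,1\}^R$, $D_R:\{0,1\}^R\to\mathbf{X}$, with distortion $\delta(E_R,D_R)=\sup_{\mathbf{x}\in\mathcal{S}}\|\mathbf{x}-D_R(E_R(\mathbf{x}))\|_{\mathbf{X}}$; $s^\ast_{\mathbf{X}}(\mathcal{S})=\sup\{s\ge0:\exists\text{ codec with }\sup_RR^s\delta(E_R,D_R)<\infty\}$. A Borel probability measure $\mathbb{P}$ on $\mathcal{S}$ (trace Borel $\sigma$-algebra) has growth order $s_0$ if for every $s>s_0$ there are $\varepsilon_0,c>0$ with $\mathbb{P}(\mathcal{S}\cap\mathcal{B}(\mathbf{x},\varepsilon;\mathbf{X}))\le2^{-c\varepsilon^{-1/s}}$ for all $\mathbf{x}\in\mathbf{X}$, $\varepsilon\in(0,\varepsilon_0)$; it is critical if $s_0=s^\ast_{\mathbf{X}}(\mathcal{S})$. *)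

theory Defs
  imports "HOL-Analysis.Analysis" "HOL-Probability.Probability"
begin

definition is_partition :: "(nat \<Rightarrow> 'i set) \<Rightarrow> bool" where
  "is_partition P \<longleftrightarrow> disjoint_family P \<and> (\<Union>m. P m) = UNIV"

definition d_regular :: "nat \<Rightarrow> (nat \<Rightarrow> 'i set) \<Rightarrow> bool" where
  "d_regular d P \<longleftrightarrow> is_partition P \<and>
     (\<exists>a A::real. 0 < a \<and> a < A \<and>
        (\<forall>m. finite (P m) \<and> a * 2 ^ (d * m) \<le> real (card (P m))
                        \<and> real (card (P m)) \<le> A * 2 ^ (d * m)))"

text \<open>Exponents p, q range over (0, \<infinity>] and are modelled as ennreal; \<infinity> = top.\<close>

definition inv_exp :: "ennreal \<Rightarrow> real" where
  "inv_exp p = (if p = \<infinity> then 0 else 1 / enn2real p)"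

definition lp_norm_fin :: "ennreal \<Rightarrow> 'i set \<Rightarrow> ('i \<Rightarrow> real) \<Rightarrow> real" where
  "lp_norm_fin p B x =
     (if p = \<infinity> then (if B = {} then 0 else Max ((\<lambda>i. \<bar>x i\<bar>) ` B))
      else (\<Sum>i\<in>B. \<bar>x i\<bar> powr enn2real p) powr (1 / enn2real p))"

definition mixed_norm :: "ennreal \<Rightarrow> ennreal \<Rightarrow> real \<Rightarrow> (nat \<Rightarrow> 'i set) \<Rightarrow> ('i \<Rightarrow> real) \<Rightarrow> ennreal" where
  "mixed_norm p q \<alpha> P x =
     (let a = (\<lambda>m. 2 powr (\<alpha> * real m) * lp_norm_fin p (P m) x) in
      if q = \<infinity> then (SUP m. ennreal (a m))
      else (let s = (\<Sum>m. ennreal (a m powr enn2real q)) in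
            if s = \<infinity> then \<infinity> else ennreal (enn2real s powr (1 / enn2real q))))"

definition mixed_unit_ball :: "ennreal \<Rightarrow> ennreal \<Rightarrow> real \<Rightarrow> (nat \<Rightarrow> 'i set) \<Rightarrow> ('i \<Rightarrow> real) set" where
  "mixed_unit_ball p q \<alpha> P = {x. mixed_norm p q \<alpha> P x \<le> 1}"

definition l2space :: "('i \<Rightarrow> real) set" where
  "l2space = {x. (\<lambda>i. (x i)\<^sup>2) summable_on UNIV}"

definition l2dist :: "('i \<Rightarrow> real) \<Rightarrow> ('i \<Rightarrow> real) \<Rightarrow> real" where
  "l2dist x y = sqrt (\<Sum>\<^sub>\<infinity>i. (x i - y i)\<^sup>2)"

definition l2top :: "('i \<Rightarrow> real) topology" where
  "l2top = Metric_space.mtopology l2space l2dist"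

definition l2borel :: "('i \<Rightarrow> real) measure" where
  "l2borel = sigma l2space {U. openin l2top U}"

definition codec_achieves :: "('i \<Rightarrow> real) set \<Rightarrow> real \<Rightarrow> bool" where
  "codec_achieves S s \<longleftrightarrow>
     (\<exists>(E :: nat \<Rightarrow> ('i \<Rightarrow> real) \<Rightarrow> bool list) (D :: nat \<Rightarrow> bool list \<Rightarrow> ('i \<Rightarrow> real)) C.
        (\<forall>R. \<forall>x\<in>S. length (E R x) = R) \<and>
        (\<forall>R bs. length bs = R \<longrightarrow> D R bs \<in> l2space) \<and>
        (\<forall>R\<ge>1. \<forall>x\<in>S. real R powr s * l2dist x (D R (E R x)) \<le> C))"

definition opt_rate :: "('i \<Rightarrow> real) set \<Rightarrow> ereal" where
  "opt_rate S = Sup (ereal ` {s. 0 \<le> s \<and> codec_achieves S s})"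

definition borel_prob_on :: "('i \<Rightarrow> real) set \<Rightarrow> ('i \<Rightarrow> real) measure \<Rightarrow> bool" where
  "borel_prob_on S M \<longleftrightarrow> prob_space M \<and> space M = S \<and>
      sets M = sets (restrict_space l2borel S)"

definition growth_order :: "('i \<Rightarrow> real) set \<Rightarrow> ('i \<Rightarrow> real) measure \<Rightarrow> real \<Rightarrow> bool" where
  "growth_order S M s0 \<longleftrightarrow>
     (\<forall>s>s0. \<exists>\<epsilon>0>0. \<exists>c>0. \<forall>x\<in>l2space. \<forall>\<epsilon>. 0 < \<epsilon> \<and> \<epsilon> < \<epsilon>0 \<longrightarrow>
        measure M (S \<inter> {y\<in>l2space. l2dist x y \<le> \<epsilon>}) \<le> 2 powr (- c * \<epsilon> powr (- 1 / s)))"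

definition critical :: "('i \<Rightarrow> real) set \<Rightarrow> ('i \<Rightarrow> real) measure \<Rightarrow> bool" where
  "critical S M \<longleftrightarrow> (\<exists>s0. opt_rate S = ereal s0 \<and> growth_order S M s0)"

end

theory Submission
  imports Defs "HOL-Real_Asymp.Real_Asymp"
begin

text \<open>
  Let \<open>s\<^sub>0 = \<alpha>/d - (1/2 - 1/p)\<close>. The \<open>m\<close>-th block of a point of the unit ball has \<open>\<ell>\<^sup>2\<close>-norm at most
  a constant times \<open>2\<^bsup>-\<gamma>m\<^esup>\<close> for some \<open>\<gamma> > 0\<close>. On a set of sequences with such bounds the \<open>\<ell>\<^sup>2\<close> topology
  is the product topology, so compactness follows from Tychonoff's theorem.

  For the codec one may assume \<open>p \<le> 2\<close>, since for \<open>p > 2\<close> the \<open>\<ell>\<^sup>2\<close>-norms of the blocks already decay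
  at the critical rate. With budget parameter \<open>J\<close>, all entries of the blocks below \<open>J\<close> are kept, and
  in each of the following blocks, up to a multiple \<open>K J\<close> of \<open>J\<close>, only the \<open>2\<^bsup>dJ\<^esup>\<close> largest ones. The kept
  entries are rounded to a grid. This costs \<open>O(J\<^sup>2 2\<^bsup>dJ\<^esup>)\<close> bits and has error \<open>O(2\<^bsup>-dJs\<^sub>0\<^esup>)\<close>; the factor
  \<open>J\<^sup>2\<close> does not affect the rate.

  The critical measure is the law of random signs, scaled on block \<open>m\<close> so that the block norms form a
  sequence of polynomial decay in the unit ball of \<open>\<ell>\<^sup>q\<close>. Whatever the centre of a ball, each coordinate
  of the random vector is far from it with probability at least 1/2, so Hoeffding's inequality on a
  single block shows that small balls have small measure. A union bound over the \<open>2\<^sup>R\<close> reconstruction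
  points of a codec then excludes every rate above \<open>s\<^sub>0\<close>.
\<close>

section \<open>The metric space of square-summable sequences\<close>

lemma power2_diff_le: "(x - y)\<^sup>2 \<le> 2 * x\<^sup>2 + 2 * (y::real)\<^sup>2"
  using zero_le_power2[of "x + y"] by (simp add: power2_eq_square algebra_simps)

lemma l2space_diff:
  assumes "x \<in> l2space" "y \<in> l2space"
  shows "(\<lambda>i. x i - y i) \<in> l2space"
  unfolding l2space_def mem_Collect_eq
proof (rule summable_on_comparison_test)
  show "(\<lambda>i. 2 * (x i)\<^sup>2 + 2 * (y i)\<^sup>2) summable_on UNIV"
    using assms unfolding l2space_def by (intro summable_on_add summable_on_cmult_right) auto
  show "(x i - y i)\<^sup>2 \<le> 2 * (x i)\<^sup>2 + 2 * (y i)\<^sup>2" for i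
    by (rule power2_diff_le)
qed auto

lemma l2space_finite_support:
  assumes "finite {i. z i \<noteq> 0}" shows "z \<in> l2space"
  unfolding l2space_def
  using assms by (auto intro: finite_nonzero_values_imp_summable_on)

lemma l2space_restrict:
  assumes "finite W" shows "(\<lambda>i. if i \<in> W then f i else 0) \<in> l2space"
  by (rule l2space_finite_support, rule finite_subset[OF _ assms]) auto

lemma zero_in_l2space [simp]: "(\<lambda>_. 0) \<in> l2space"
  by (simp add: l2space_def)

lemma L2_set_le_l2dist:
  assumes "x \<in> l2space" "y \<in> l2space" "finite F"
  shows "L2_set (\<lambda>i. x i - y i) F \<le> l2dist x y"
proof -
  have "(\<Sum>i\<in>F. (x i - y i)\<^sup>2) \<le> (\<Sum>\<^sub>\<infinity>i. (x i - y i)\<^sup>2)"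
    using l2space_diff[OF assms(1,2)] assms(3)
    by (intro finite_sum_le_infsum) (auto simp: l2space_def)
  then show ?thesis by (simp add: L2_set_def l2dist_def)
qed

lemma l2dist_nonneg: "0 \<le> l2dist x y"
  by (simp add: l2dist_def infsum_nonneg)

lemma l2dist_le_iff:
  assumes "x \<in> l2space" "y \<in> l2space"
  shows "l2dist x y \<le> c \<longleftrightarrow> (\<forall>F. finite F \<longrightarrow> L2_set (\<lambda>i. x i - y i) F \<le> c)"
proof (intro iffI allI impI)
  assume sections_le: "\<forall>F. finite F \<longrightarrow> L2_set (\<lambda>i. x i - y i) F \<le> c"
  then have "0 \<le> c" by (metis L2_set_empty finite.emptyI)
  have "(\<Sum>\<^sub>\<infinity>i. (x i - y i)\<^sup>2) \<le> c\<^sup>2"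
  proof (rule infsum_le_finite_sums)
    show "(\<lambda>i. (x i - y i)\<^sup>2) summable_on UNIV"
      using l2space_diff[OF assms] by (simp add: l2space_def)
    show "(\<Sum>i\<in>F. (x i - y i)\<^sup>2) \<le> c\<^sup>2" if "finite F" for F
      using sections_le that by (simp add: L2_set_def sqrt_le_D)
  qed
  then show "l2dist x y \<le> c" unfolding l2dist_def using \<open>0 \<le> c\<close> by (simp add: real_le_lsqrt)
qed (use L2_set_le_l2dist[OF assms] order_trans in blast)

lemma l2dist_triangle:
  assumes "x \<in> l2space" "y \<in> l2space" "z \<in> l2space"
  shows "l2dist x z \<le> l2dist x y + l2dist y z"
  unfolding l2dist_le_iff[OF assms(1,3)]
proof (intro allI impI)
  fix F :: "'a set" assume finite_F: "finite F"
  have "L2_set (\<lambda>i. x i - z i) F \<le> L2_set (\<lambda>i. x i - y i) F + L2_set (\<lambda>i. y i - z i) F"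
    using L2_set_triangle_ineq[of "\<lambda>i. x i - y i" "\<lambda>i. y i - z i" F] by simp
  also have "\<dots> \<le> l2dist x y + l2dist y z"
    by (intro add_mono L2_set_le_l2dist assms finite_F)
  finally show "L2_set (\<lambda>i. x i - z i) F \<le> l2dist x y + l2dist y z" .
qed

interpretation l2: Metric_space l2space l2dist
proof
  show "l2dist x y = l2dist y x" for x y :: "'a \<Rightarrow> real"
    by (simp add: l2dist_def power2_commute)
  show "l2dist x y = 0 \<longleftrightarrow> x = y" if "x \<in> l2space" "y \<in> l2space" for x y :: "'a \<Rightarrow> real"
  proof
    assume dist_zero: "l2dist x y = 0"
    have "\<bar>x i - y i\<bar> \<le> 0" for i
      using L2_set_le_l2dist[OF that, of "{i}"] dist_zero by simp
    then show "x = y" by (intro ext) simp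
  qed (simp add: l2dist_def)
qed (auto intro: l2dist_nonneg l2dist_triangle)

lemma topspace_l2top [simp]: "topspace l2top = l2space"
  by (simp add: l2top_def)

lemma space_l2borel [simp]: "space l2borel = l2space"
  unfolding l2borel_def using openin_subset[of l2top] by (subst space_measure_of) auto

lemma openin_sets_l2borel: "openin l2top U \<Longrightarrow> U \<in> sets l2borel"
  unfolding l2borel_def using openin_subset[of l2top] by (subst sets_measure_of) auto

lemma closedin_sets_l2borel:
  assumes "closedin l2top U" shows "U \<in> sets l2borel"
proof -
  have "U = space l2borel - (topspace l2top - U)"
    using closedin_subset[OF assms] by auto
  moreover have "topspace l2top - U \<in> sets l2borel"
    using assms unfolding closedin_def by (intro openin_sets_l2borel) blast
  ultimately show ?thesis by (metis sets.compl_sets)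
qed

lemma compactin_sets_l2borel: "compactin l2top K \<Longrightarrow> K \<in> sets l2borel"
  using compactin_imp_closedin[OF l2.Hausdorff_space_mtopology]
  by (intro closedin_sets_l2borel) (simp add: l2top_def)

lemma closed_ball_sets_l2borel:
  assumes "x \<in> l2space" shows "{y \<in> l2space. l2dist x y \<le> r} \<in> sets l2borel"
proof -
  have "{y \<in> l2space. l2dist x y \<le> r} = l2.mcball x r"
    using assms by (auto simp: l2.mcball_def)
  then show ?thesis
    by (auto intro: closedin_sets_l2borel simp: l2top_def)
qed

lemma measurable_l2borel_continuous_map:
  assumes "continuous_map euclidean l2top f"
  shows "f \<in> measurable borel l2borel"
  unfolding l2borel_def
proof (rule measurable_measure_of)
  show "{U. openin l2top U} \<subseteq> Pow l2space" using openin_subset[of l2top] by auto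
  show "f \<in> space borel \<rightarrow> l2space"
    using continuous_map_funspace[OF assms] by auto
  show "f -` U \<inter> space borel \<in> sets borel" if "U \<in> {U. openin l2top U}" for U
    using openin_continuous_map_preimage[OF assms, of U] that by (simp add: vimage_def)
qed

section \<open>Sequences split into finite blocks\<close>

locale finite_blocks =
  fixes P :: "nat \<Rightarrow> 'i set"
  assumes finite_block: "finite (P m)" and disjoint_blocks: "disjoint_family P"
    and blocks_cover: "(\<Union>m. P m) = UNIV"
begin

definition block_dominated :: "(nat \<Rightarrow> real) \<Rightarrow> ('i \<Rightarrow> real) set" where
  "block_dominated c = {x. \<forall>m. (\<Sum>i\<in>P m. (x i)\<^sup>2) \<le> c m}"

lemma finite_subset_blocks:
  assumes "finite F" shows "\<exists>N. F \<subseteq> (\<Union>m<N. P m)"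
  using assms
proof (induction F)
  case (insert x F)
  then obtain N where "F \<subseteq> (\<Union>m<N. P m)" by auto
  moreover obtain m where "x \<in> P m" using blocks_cover by (metis UNIV_I UN_E)
  ultimately
  show ?case by (intro exI[of _ "max N (Suc m)"]) (force simp: less_max_iff_disj)
qed auto

lemma block_dominated_nonneg:
  assumes "x \<in> block_dominated c" shows "0 \<le> c m"
proof -
  have "0 \<le> (\<Sum>i\<in>P m. (x i)\<^sup>2)" by (intro sum_nonneg) simp
  also have "\<dots> \<le> c m" using assms by (simp add: block_dominated_def)
  finally show ?thesis .
qed

lemma sum_squares_le_suminf_blocks:
  assumes x_dominated: "x \<in> block_dominated c" and summable_c: "summable c" and finite_F: "finite F"
  shows "(\<Sum>i\<in>F. (x i)\<^sup>2) \<le> suminf c"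
proof -
  obtain N where F_subset: "F \<subseteq> (\<Union>m<N. P m)" using finite_subset_blocks[OF finite_F] by auto
  have "(\<Sum>i\<in>F. (x i)\<^sup>2) \<le> (\<Sum>i\<in>(\<Union>m<N. P m). (x i)\<^sup>2)"
    by (rule sum_mono2) (use F_subset finite_block in auto)
  also have "\<dots> = (\<Sum>m<N. \<Sum>i\<in>P m. (x i)\<^sup>2)"
    by (rule sum.UNION_disjoint)
      (use finite_block disjoint_blocks in \<open>auto simp: disjoint_family_on_def\<close>)
  also have "\<dots> \<le> (\<Sum>m<N. c m)" using x_dominated by (intro sum_mono) (simp add: block_dominated_def)
  also have "\<dots> \<le> suminf c"
    using summable_c block_dominated_nonneg[OF x_dominated] by (intro sum_le_suminf) auto
  finally show ?thesis .
qed

lemma block_dominated_subset_l2space: "summable c \<Longrightarrow> block_dominated c \<subseteq> l2space"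
  using sum_squares_le_suminf_blocks unfolding l2space_def
  by (fastforce intro!: nonneg_bdd_above_summable_on bdd_aboveI)

lemma l2dist_le_blocks:
  assumes "x \<in> l2space" "y \<in> l2space" "(\<lambda>i. x i - y i) \<in> block_dominated c" "summable c"
  shows "l2dist x y \<le> sqrt (suminf c)"
  unfolding l2dist_le_iff[OF assms(1,2)] L2_set_def
  using sum_squares_le_suminf_blocks[OF assms(3,4)] by simp

lemma block_dominated_l2dist_le:
  assumes x_dominated: "x \<in> block_dominated c" and y_dominated: "y \<in> block_dominated c"
    and summable_c: "summable c"
  shows "l2dist x y \<le> sqrt ((\<Sum>m<N. \<Sum>i\<in>P m. (x i - y i)\<^sup>2) + 4 * (\<Sum>m. c (m + N)))"
proof -
  define b where "b m = (if m < N then \<Sum>i\<in>P m. (x i - y i)\<^sup>2 else 4 * c m)" for m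
  have "(\<Sum>i\<in>P m. (x i - y i)\<^sup>2) \<le> 4 * c m" for m
  proof -
    have "(\<Sum>i\<in>P m. (x i - y i)\<^sup>2) \<le> (\<Sum>i\<in>P m. 2 * (x i)\<^sup>2 + 2 * (y i)\<^sup>2)"
      by (intro sum_mono power2_diff_le)
    also have "\<dots> = 2 * (\<Sum>i\<in>P m. (x i)\<^sup>2) + 2 * (\<Sum>i\<in>P m. (y i)\<^sup>2)"
      by (simp add: sum.distrib sum_distrib_left)
    also have "\<dots> \<le> 2 * c m + 2 * c m"
      using x_dominated y_dominated
      by (intro add_mono mult_left_mono) (auto simp: block_dominated_def)
    finally show ?thesis by simp
  qed
  then have "(\<lambda>i. x i - y i) \<in> block_dominated b" by (simp add: block_dominated_def b_def)
  moreover have summable_tail: "summable (\<lambda>m. c (m + N))"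
    using summable_c by (simp add: summable_iff_shift)
  then have summable_b: "summable b"
    by (subst summable_iff_shift[symmetric, of _ N]) (simp add: b_def summable_mult)
  moreover have "suminf b = (\<Sum>m<N. \<Sum>i\<in>P m. (x i - y i)\<^sup>2) + 4 * (\<Sum>m. c (m + N))"
    using suminf_split_initial_segment[OF summable_b, of N] summable_tail
    by (simp add: b_def suminf_mult)
  ultimately show ?thesis
    using l2dist_le_blocks[of x y b] block_dominated_subset_l2space[OF summable_c] x_dominated y_dominated
    by auto
qed

lemma continuous_map_block_dominated:
  assumes summable_c: "summable c"
  shows "continuous_map (top_of_set (block_dominated c)) l2top (\<lambda>x. x)"
  unfolding l2top_def l2.continuous_map_to_metric
proof (intro ballI allI impI)
  fix x and e :: real
  assume "x \<in> topspace (top_of_set (block_dominated c))" and e_pos: "e > 0"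
  then have x_dominated: "x \<in> block_dominated c" by simp
  have "(\<lambda>N. 4 * (\<Sum>m. c (m + N))) \<longlonglongrightarrow> 4 * 0"
    by (intro tendsto_mult_left suminf_exist_split2 summable_c)
  then have "\<forall>\<^sub>F N in sequentially. 4 * (\<Sum>m. c (m + N)) < e\<^sup>2"
    using e_pos by (intro order_tendstoD(2)[where y = "4 * 0"]) auto
  then obtain N where tail_small: "4 * (\<Sum>m. c (m + N)) < e\<^sup>2"
    by (auto simp: eventually_sequentially)
  define g where "g y = (\<Sum>m<N. \<Sum>i\<in>P m. (x i - y i)\<^sup>2) + 4 * (\<Sum>m. c (m + N))" for y
  define U where "U = block_dominated c \<inter> {y. g y < e\<^sup>2}"
  have "continuous_on UNIV g" unfolding g_def by (intro continuous_intros) auto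
  then have "open {y. g y < e\<^sup>2}" by (intro open_Collect_less) auto
  then have "openin (top_of_set (block_dominated c)) U" unfolding U_def by auto
  moreover have "x \<in> U" using x_dominated tail_small by (simp add: U_def g_def)
  moreover have "y \<in> l2.mball x e" if "y \<in> U" for y
  proof -
    have y_dominated: "y \<in> block_dominated c" and "g y < e\<^sup>2" using that by (auto simp: U_def)
    have "l2dist x y \<le> sqrt (g y)"
      unfolding g_def by (rule block_dominated_l2dist_le[OF x_dominated y_dominated summable_c])
    also have "\<dots> < e" using \<open>g y < e\<^sup>2\<close> e_pos by (simp add: real_less_lsqrt)
    finally show ?thesis
      using x_dominated y_dominated block_dominated_subset_l2space[OF summable_c]
      by (auto simp: l2.in_mball)
  qed
  ultimately show "\<exists>U. openin (top_of_set (block_dominated c)) U \<and> x \<in> U \<and> (\<forall>y\<in>U. y \<in> l2.mball x e)"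
    by blast
qed

lemma compactin_l2top_block_dominated:
  assumes S_closed_dominated: "closed S" "S \<subseteq> block_dominated c" and summable_c: "summable c"
  shows "compactin l2top S"
proof -
  define r where "r = sqrt (suminf c)"
  have "x i \<in> {- r..r}" if "x \<in> S" for x i
  proof -
    have "\<bar>x i\<bar> \<le> r"
      using sum_squares_le_suminf_blocks[of x c "{i}"] that S_closed_dominated summable_c
      by (auto simp: r_def intro!: real_le_rsqrt)
    then show ?thesis by auto
  qed
  then have "S \<subseteq> (\<Pi>\<^sub>E i\<in>UNIV. {- r..r})" by auto
  moreover have "compactin (product_topology (\<lambda>i::'i. euclidean) UNIV) (\<Pi>\<^sub>E i\<in>UNIV. {- r..r})"
    by (simp add: compactin_PiE)
  then have "compact (\<Pi>\<^sub>E i\<in>(UNIV::'i set). {- r..r})" by (simp add: euclidean_product_topology)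
  ultimately have "compact S"
    using S_closed_dominated(1) by (metis compact_Int_closed inf.absorb_iff2)
  then have "compactin (top_of_set (block_dominated c)) S"
    using S_closed_dominated(2) by (simp add: compactin_subtopology)
  from image_compactin[OF this continuous_map_block_dominated[OF summable_c]]
  show ?thesis by simp
qed

end

section \<open>Finite-dimensional norms and the mixed unit ball\<close>

lemma enn2real_exponent_pos: "0 < p \<Longrightarrow> p \<noteq> \<infinity> \<Longrightarrow> 0 < enn2real p"
  by (simp add: enn2real_positive_iff top.not_eq_extremum)

lemma inv_exp_nonneg: "0 \<le> inv_exp p"
  by (simp add: inv_exp_def)

lemma enn2real_le_two: "p \<le> 2 \<Longrightarrow> enn2real p \<le> 2"
  using enn2real_mono[of p 2] by simp

lemma half_le_inv_exp_iff:
  assumes "0 < p" shows "1/2 \<le> inv_exp p \<longleftrightarrow> p \<le> 2"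
proof (cases p)
  case (real r)
  then show ?thesis using assms by (simp add: inv_exp_def field_simps flip: ennreal_numeral)
qed (simp add: inv_exp_def top_unique)

lemma powr_le_powr_iff:
  fixes r s e :: real assumes "0 \<le> r" "0 \<le> s" "0 < e" shows "r powr e \<le> s powr e \<longleftrightarrow> r \<le> s"
  using assms powr_mono2[of e r s] powr_less_mono2[of e s r] by fastforce

lemma powr_le_one_iff:
  fixes r e :: real assumes "0 \<le> r" "0 < e" shows "r powr e \<le> 1 \<longleftrightarrow> r \<le> 1"
  using powr_le_powr_iff[of r 1 e] assms by simp

lemma lp_norm_fin_nonneg: "finite B \<Longrightarrow> 0 \<le> lp_norm_fin p B x"
  by (auto simp: lp_norm_fin_def Max_ge_iff intro: order_trans[OF abs_ge_zero])

lemma lp_norm_fin_le_iff: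
  assumes "0 < p" "p \<noteq> \<infinity>" "0 \<le> c"
  shows "lp_norm_fin p B x \<le> c \<longleftrightarrow> (\<Sum>i\<in>B. \<bar>x i\<bar> powr enn2real p) \<le> c powr enn2real p"
proof -
  define r where "r = enn2real p"
  have r_pos: "0 < r" unfolding r_def by (rule enn2real_exponent_pos[OF assms(1,2)])
  have "lp_norm_fin p B x \<le> c \<longleftrightarrow> (\<Sum>i\<in>B. \<bar>x i\<bar> powr r) powr (1 / r) \<le> (c powr r) powr (1 / r)"
    using assms r_pos by (simp add: lp_norm_fin_def powr_powr flip: r_def)
  also have "\<dots> \<longleftrightarrow> (\<Sum>i\<in>B. \<bar>x i\<bar> powr r) \<le> c powr r"
    using r_pos by (intro powr_le_powr_iff sum_nonneg) auto
  finally show ?thesis unfolding r_def .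
qed

lemma abs_le_lp_norm_fin:
  assumes "0 < p" "finite B" "i \<in> B"
  shows "\<bar>x i\<bar> \<le> lp_norm_fin p B x"
proof (cases "p = \<infinity>")
  case True
  then show ?thesis using assms by (auto simp: lp_norm_fin_def)
next
  case False
  define c where "c = lp_norm_fin p B x"
  have c_nonneg: "0 \<le> c" unfolding c_def by (rule lp_norm_fin_nonneg[OF assms(2)])
  have "\<bar>x i\<bar> powr enn2real p \<le> (\<Sum>i\<in>B. \<bar>x i\<bar> powr enn2real p)"
    using assms by (intro member_le_sum) auto
  also have "\<dots> \<le> c powr enn2real p"
    using lp_norm_fin_le_iff[OF assms(1) False c_nonneg, of B x] by (simp add: c_def)
  finally show ?thesis
    using c_nonneg enn2real_exponent_pos[OF assms(1) False]
    by (simp add: powr_le_powr_iff flip: c_def)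
qed

lemma lp_norm_fin_two: "lp_norm_fin 2 B x = L2_set x B"
  by (simp add: lp_norm_fin_def L2_set_def powr_half_sqrt sum_nonneg)

lemma lp_norm_fin_le_of_bounded:
  assumes p_pos: "0 < p" and finite_B: "finite B" and x_le: "\<And>i. i \<in> B \<Longrightarrow> \<bar>x i\<bar> \<le> r"
    and r_nonneg: "0 \<le> r"
  shows "lp_norm_fin p B x \<le> real (card B) powr inv_exp p * r"
proof (cases "p = \<infinity>")
  case True
  then show ?thesis using x_le finite_B by (auto simp: lp_norm_fin_def inv_exp_def card_eq_0_iff)
next
  case False
  have exponent_pos: "0 < enn2real p" using enn2real_exponent_pos[OF p_pos False] .
  have "(\<Sum>i\<in>B. \<bar>x i\<bar> powr enn2real p) \<le> (\<Sum>i\<in>B. r powr enn2real p)"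
    using x_le exponent_pos by (intro sum_mono powr_mono2) auto
  also have "\<dots> = (real (card B) powr inv_exp p * r) powr enn2real p"
    using False exponent_pos r_nonneg by (simp add: powr_mult powr_powr inv_exp_def)
  finally show ?thesis
    using lp_norm_fin_le_iff[OF p_pos False, of "real (card B) powr inv_exp p * r" B x] r_nonneg
    by simp
qed

lemma sum_powr_le_card_powr:
  fixes y :: "'a \<Rightarrow> real"
  assumes finite_B: "finite B" and y_nonneg: "\<And>i. i \<in> B \<Longrightarrow> 0 \<le> y i" and r_ge_one: "1 \<le> r"
  shows "(\<Sum>i\<in>B. y i) powr r \<le> real (card B) powr (r - 1) * (\<Sum>i\<in>B. y i powr r)"
proof -
  define B' where "B' = {i \<in> B. 0 < y i}"
  define n where "n = real (card B')"
  have B'_finite_subset: "finite B'" "B' \<subseteq> B" using finite_B by (auto simp: B'_def)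
  have sum_B': "(\<Sum>i\<in>B. f (y i)) = (\<Sum>i\<in>B'. f (y i))" if "f 0 = 0" for f :: "real \<Rightarrow> real"
    using finite_B y_nonneg that by (intro sum.mono_neutral_right) (force simp: B'_def)+
  show ?thesis
  proof (cases "B' = {}")
    case False
    then have n_pos: "0 < n" using B'_finite_subset by (simp add: n_def card_gt_0_iff)
    have "(\<Sum>i\<in>B'. (1 / n) *\<^sub>R y i) powr r \<le> (\<Sum>i\<in>B'. 1 / n * y i powr r)"
      using B'_finite_subset False n_pos
      by (intro convex_on_sum[OF _ _ powr_convex[OF r_ge_one]]) (auto simp: n_def B'_def)
    then have "((\<Sum>i\<in>B'. y i) / n) powr r \<le> (\<Sum>i\<in>B'. y i powr r) / n"
      by (simp add: sum_divide_distrib)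
    then have "(\<Sum>i\<in>B'. y i) powr r \<le> n powr (r - 1) * (\<Sum>i\<in>B'. y i powr r)"
      using n_pos by (simp add: powr_divide powr_diff field_simps)
    also have "\<dots> \<le> real (card B) powr (r - 1) * (\<Sum>i\<in>B'. y i powr r)"
      using r_ge_one card_mono[OF finite_B B'_finite_subset(2)]
      by (intro mult_right_mono powr_mono2 sum_nonneg) (auto simp: n_def)
    finally show ?thesis using sum_B'[of "\<lambda>v. v"] sum_B'[of "\<lambda>v. v powr r"] r_ge_one by simp
  qed (use sum_B'[of "\<lambda>v. v"] in \<open>simp add: sum_nonneg\<close>)
qed

lemma square_le_powr_mult:
  fixes v r t :: real
  assumes "r \<le> 2" "\<bar>v\<bar> \<le> t"
  shows "v\<^sup>2 \<le> t powr (2 - r) * \<bar>v\<bar> powr r"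
proof (cases "v = 0")
  case False
  then have "v\<^sup>2 = \<bar>v\<bar> powr (2 - r) * \<bar>v\<bar> powr r" by (simp flip: powr_add)
  also have "\<dots> \<le> t powr (2 - r) * \<bar>v\<bar> powr r"
    using assms by (intro mult_right_mono powr_mono2) auto
  finally show ?thesis .
qed simp

lemma L2_set_le_lp_norm_fin_small_exponent:
  assumes p_bounds: "0 < p" "p \<le> 2" and finite_B: "finite B"
  shows "L2_set x B \<le> lp_norm_fin p B x"
proof -
  define r where "r = enn2real p"
  define c where "c = lp_norm_fin p B x"
  have p_finite: "p \<noteq> \<infinity>" using p_bounds by (auto simp: top_unique)
  have r_bounds: "0 < r" "r \<le> 2"
    using enn2real_exponent_pos[OF p_bounds(1) p_finite] enn2real_le_two[OF p_bounds(2)]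
    by (simp_all add: r_def)
  have c_nonneg: "0 \<le> c" unfolding c_def by (rule lp_norm_fin_nonneg[OF finite_B])
  have "(\<Sum>i\<in>B. (x i)\<^sup>2) \<le> (\<Sum>i\<in>B. c powr (2 - r) * \<bar>x i\<bar> powr r)"
    unfolding c_def
    by (intro sum_mono square_le_powr_mult r_bounds abs_le_lp_norm_fin p_bounds finite_B)
  also have "\<dots> = c powr (2 - r) * (\<Sum>i\<in>B. \<bar>x i\<bar> powr r)" by (simp add: sum_distrib_left)
  also have "\<dots> \<le> c powr (2 - r) * c powr r"
    using lp_norm_fin_le_iff[OF p_bounds(1) p_finite c_nonneg, of B x]
    by (intro mult_left_mono) (auto simp: r_def c_def)
  also have "\<dots> = c\<^sup>2" using c_nonneg r_bounds by (cases "c = 0") (simp_all flip: powr_add)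
  finally show ?thesis using c_nonneg by (simp add: L2_set_def real_le_lsqrt flip: c_def)
qed

lemma L2_set_le_lp_norm_fin_large_exponent:
  assumes p_ge_two: "2 \<le> p" and finite_B: "finite B"
  shows "L2_set x B \<le> real (card B) powr (1/2 - inv_exp p) * lp_norm_fin p B x"
proof (cases "p = \<infinity>")
  case True
  have "L2_set x B \<le> real (card B) powr (1/2) * lp_norm_fin p B x"
    using lp_norm_fin_le_of_bounded[of 2 B x "lp_norm_fin p B x"] abs_le_lp_norm_fin[of p B _ x]
      lp_norm_fin_nonneg[OF finite_B] finite_B p_ge_two True
        by (simp add: lp_norm_fin_two inv_exp_def)
  then show ?thesis using True by (simp add: inv_exp_def)
next
  case False
  define r where "r = enn2real p"
  define n where "n = real (card B)"
  define T where "T = (\<Sum>i\<in>B. \<bar>x i\<bar> powr r)"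
  have r_ge_two: "2 \<le> r"
    using enn2real_mono[of 2 p] p_ge_two False by (simp add: r_def top.not_eq_extremum)
  have T_nonneg: "0 \<le> T" unfolding T_def by (intro sum_nonneg) simp
  have "(\<Sum>i\<in>B. (x i)\<^sup>2) powr (r / 2) \<le> n powr (r / 2 - 1) * (\<Sum>i\<in>B. (x i)\<^sup>2 powr (r / 2))"
    unfolding n_def using r_ge_two finite_B by (intro sum_powr_le_card_powr) auto
  also have "(\<Sum>i\<in>B. (x i)\<^sup>2 powr (r / 2)) = T"
  proof -
    have "(\<bar>x i\<bar> powr 2) powr (r / 2) = \<bar>x i\<bar> powr r" for i
      by (simp only: powr_powr) simp
    then show ?thesis by (simp add: T_def)
  qed
  finally have "((\<Sum>i\<in>B. (x i)\<^sup>2) powr (r / 2)) powr (1 / r) \<le> (n powr (r / 2 - 1) * T) powr (1 / r)"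
    using r_ge_two by (intro powr_mono2) auto
  also have "((\<Sum>i\<in>B. (x i)\<^sup>2) powr (r / 2)) powr (1 / r) = L2_set x B"
    using r_ge_two by (simp add: powr_powr powr_half_sqrt sum_nonneg L2_set_def)
  also have "(n powr (r / 2 - 1) * T) powr (1 / r) = n powr ((r / 2 - 1) * (1 / r)) * T powr (1 / r)"
    by (simp add: powr_mult powr_powr)
  also have "(r / 2 - 1) * (1 / r) = 1/2 - inv_exp p"
    using r_ge_two False by (simp add: inv_exp_def r_def field_simps)
  also have "T powr (1 / r) = lp_norm_fin p B x"
    using False by (simp add: T_def r_def lp_norm_fin_def)
  finally show ?thesis by (simp add: n_def)
qed

lemma L2_set_le_lp_norm_fin:
  assumes p_pos: "0 < p" and finite_B: "finite B"
  shows "L2_set x B \<le> real (card B) powr max 0 (1/2 - inv_exp p) * lp_norm_fin p B x"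
proof (cases "p \<le> 2")
  case True
  then have "max 0 (1/2 - inv_exp p) = 0" using half_le_inv_exp_iff[OF p_pos] by simp
  then show ?thesis
    using L2_set_le_lp_norm_fin_small_exponent[OF p_pos True finite_B, of x]
    by (cases "B = {}") (simp_all add: finite_B)
next
  case False
  then have "max 0 (1/2 - inv_exp p) = 1/2 - inv_exp p" using half_le_inv_exp_iff[OF p_pos] by simp
  then show ?thesis using L2_set_le_lp_norm_fin_large_exponent[of p B x] False finite_B by simp
qed

lemma stechkin_sparse_approximation:
  assumes p_bounds: "0 < p" "p \<le> 2" and finite_B: "finite B" and norm_le: "lp_norm_fin p B x \<le> c"
    and c_pos: "0 < c" and N_pos: "0 < N"
  obtains W where "W \<subseteq> B" "real (card W) \<le> N"
    "(\<Sum>i\<in>B - W. (x i)\<^sup>2) \<le> c\<^sup>2 * N powr (1 - 2 * inv_exp p)"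
proof
  define r where "r = enn2real p"
  define t where "t = c * N powr (- (1 / r))"
  define W where "W = {i \<in> B. t < \<bar>x i\<bar>}"
  have p_finite: "p \<noteq> \<infinity>" using p_bounds by (auto simp: top_unique)
  have r_bounds: "0 < r" "r \<le> 2"
    using enn2real_exponent_pos[OF p_bounds(1) p_finite] enn2real_le_two[OF p_bounds(2)]
    by (simp_all add: r_def)
  have sum_x: "(\<Sum>i\<in>B. \<bar>x i\<bar> powr r) \<le> c powr r"
    using lp_norm_fin_le_iff[OF p_bounds(1) p_finite, of c B x] norm_le c_pos by (simp add: r_def)
  have t_pos: "0 < t" using c_pos N_pos by (simp add: t_def)
  show "W \<subseteq> B" by (auto simp: W_def)
  have "real (card W) * t powr r = (\<Sum>i\<in>W. t powr r)" by simp
  also have "\<dots> \<le> (\<Sum>i\<in>W. \<bar>x i\<bar> powr r)"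
    using r_bounds t_pos by (intro sum_mono powr_mono2) (auto simp: W_def)
  also have "\<dots> \<le> (\<Sum>i\<in>B. \<bar>x i\<bar> powr r)" using finite_B by (intro sum_mono2) (auto simp: W_def)
  also note sum_x
  also have "c powr r = N * t powr r"
    using r_bounds c_pos N_pos by (simp add: t_def powr_mult powr_powr powr_neg_one)
  finally show "real (card W) \<le> N" using t_pos by simp
  have "(\<Sum>i\<in>B - W. (x i)\<^sup>2) \<le> (\<Sum>i\<in>B - W. t powr (2 - r) * \<bar>x i\<bar> powr r)"
    using r_bounds by (intro sum_mono square_le_powr_mult) (auto simp: W_def)
  also have "\<dots> = t powr (2 - r) * (\<Sum>i\<in>B - W. \<bar>x i\<bar> powr r)" by (simp add: sum_distrib_left)
  also have "\<dots> \<le> t powr (2 - r) * (\<Sum>i\<in>B. \<bar>x i\<bar> powr r)"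
    using finite_B by (intro mult_left_mono sum_mono2) auto
  also have "\<dots> \<le> t powr (2 - r) * c powr r" by (intro mult_left_mono sum_x) simp
  also have "\<dots> = c powr (2 - r) * c powr r * N powr (- (1 / r) * (2 - r))"
    using c_pos N_pos by (simp add: t_def powr_mult powr_powr)
  also have "c powr (2 - r) * c powr r = c\<^sup>2" using c_pos by (simp flip: powr_add)
  also have "- (1 / r) * (2 - r) = 1 - 2 * inv_exp p"
    using r_bounds p_finite by (simp add: inv_exp_def r_def field_simps)
  finally show "(\<Sum>i\<in>B - W. (x i)\<^sup>2) \<le> c\<^sup>2 * N powr (1 - 2 * inv_exp p)" .
qed

lemma continuous_on_lp_norm_fin:
  fixes B :: "'i set"
  assumes "p > 0" "finite B" shows "continuous_on UNIV (lp_norm_fin p B)"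
proof (cases "p = \<infinity>")
  case True
  have "continuous_on UNIV (\<lambda>x. Max ((\<lambda>i. \<bar>x i :: real\<bar>) ` B))" if "B \<noteq> {}"
    using assms(2) that
  proof (induction B rule: finite_ne_induct)
    case (insert i F)
    have "Max ((\<lambda>i. \<bar>x i\<bar>) ` insert i F) = max \<bar>x i\<bar> (Max ((\<lambda>i. \<bar>x i\<bar>) ` F))" for x :: "'i \<Rightarrow> real"
      using insert by simp
    then show ?case using insert by (auto intro!: continuous_intros)
  qed (auto intro!: continuous_intros)
  then show ?thesis using True by (cases "B = {}") (auto simp: lp_norm_fin_def[abs_def])
next
  case False
  then show ?thesis using enn2real_exponent_pos[OF assms(1) False]
    by (auto simp: lp_norm_fin_def[abs_def] intro!: continuous_intros continuous_on_powr' sum_nonneg)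
qed

definition scaled_norm :: "ennreal \<Rightarrow> real \<Rightarrow> (nat \<Rightarrow> 'i set) \<Rightarrow> ('i \<Rightarrow> real) \<Rightarrow> nat \<Rightarrow> real" where
  "scaled_norm p \<alpha> P x m = 2 powr (\<alpha> * real m) * lp_norm_fin p (P m) x"

definition block_ball :: "(nat \<Rightarrow> 'i set) \<Rightarrow> ennreal \<Rightarrow> real \<Rightarrow> real \<Rightarrow> ('i \<Rightarrow> real) set" where
  "block_ball P p C \<beta> = {x. \<forall>m. lp_norm_fin p (P m) x \<le> C * 2 powr (- \<beta> * real m)}"

lemma block_ball_mono: "C \<le> C' \<Longrightarrow> block_ball P p C \<beta> \<subseteq> block_ball P p C' \<beta>"
  by (auto simp: block_ball_def intro: order_trans mult_right_mono)

lemma mixed_unit_ball_iff: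
  assumes q_pos: "q > 0" and finite_P: "\<And>m. finite (P m)"
  shows "x \<in> mixed_unit_ball p q \<alpha> P \<longleftrightarrow>
    (if q = \<infinity> then \<forall>m. scaled_norm p \<alpha> P x m \<le> 1
     else \<forall>N. (\<Sum>m<N. scaled_norm p \<alpha> P x m powr enn2real q) \<le> 1)"
proof (cases "q = \<infinity>")
  case True
  then show ?thesis
    by (simp add: mixed_unit_ball_def mixed_norm_def scaled_norm_def[abs_def] SUP_le_iff)
next
  case False
  define s where "s = (\<Sum>m. ennreal (scaled_norm p \<alpha> P x m powr enn2real q))"
  have "mixed_norm p q \<alpha> P x = (if s = \<infinity> then \<infinity> else ennreal (enn2real s powr (1 / enn2real q)))"
    using False by (simp add: mixed_norm_def scaled_norm_def s_def)
  also have "\<dots> \<le> 1 \<longleftrightarrow> s \<le> 1"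
  proof (cases s)
    case (real r)
    then show ?thesis
      using powr_le_one_iff[of r "1 / enn2real q"] enn2real_exponent_pos[OF q_pos False] by simp
  qed (simp add: top_unique)
  also have "s \<le> 1 \<longleftrightarrow> (\<forall>N. (\<Sum>m<N. scaled_norm p \<alpha> P x m powr enn2real q) \<le> 1)"
    by (simp add: s_def suminf_eq_SUP SUP_le_iff sum_ennreal)
  finally show ?thesis using False by (simp add: mixed_unit_ball_def)
qed

context finite_blocks
begin

lemma scaled_norm_nonneg: "0 \<le> scaled_norm p \<alpha> P x m"
  by (simp add: scaled_norm_def lp_norm_fin_nonneg finite_block)

lemma closed_mixed_unit_ball:
  assumes p_pos: "p > 0" and q_pos: "q > 0"
  shows "closed (mixed_unit_ball p q \<alpha> P)"
proof -
  have scaled: "continuous_on UNIV (\<lambda>x. scaled_norm p \<alpha> P x m)" for m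
    unfolding scaled_norm_def using continuous_on_lp_norm_fin[OF p_pos finite_block]
    by (intro continuous_intros)
  show ?thesis
  proof (cases "q = \<infinity>")
    case True
    then have "mixed_unit_ball p q \<alpha> P = (\<Inter>m. {x. scaled_norm p \<alpha> P x m \<le> 1})"
      using mixed_unit_ball_iff[OF q_pos finite_block] by auto
    then show ?thesis using scaled by (auto intro!: closed_INT closed_Collect_le)
  next
    case False
    then have "mixed_unit_ball p q \<alpha> P =
        (\<Inter>N. {x. (\<Sum>m<N. scaled_norm p \<alpha> P x m powr enn2real q) \<le> 1})"
      using mixed_unit_ball_iff[OF q_pos finite_block] by auto
    moreover have "continuous_on UNIV (\<lambda>x. \<Sum>m<N. scaled_norm p \<alpha> P x m powr enn2real q)" for N
      using scaled enn2real_exponent_pos[OF q_pos False] scaled_norm_nonneg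
      by (intro continuous_on_sum continuous_on_powr') auto
    ultimately show ?thesis by (auto intro!: closed_INT closed_Collect_le)
  qed
qed

lemma scaled_norm_le_one:
  assumes q_pos: "q > 0" and x_ball: "x \<in> mixed_unit_ball p q \<alpha> P"
  shows "scaled_norm p \<alpha> P x m \<le> 1"
proof (cases "q = \<infinity>")
  case True
  then show ?thesis using x_ball mixed_unit_ball_iff[OF q_pos finite_block] by auto
next
  case False
  have "scaled_norm p \<alpha> P x m powr enn2real q \<le> (\<Sum>m<Suc m. scaled_norm p \<alpha> P x m powr enn2real q)"
    by (rule member_le_sum) auto
  also have "\<dots> \<le> 1"
    using x_ball False mixed_unit_ball_iff[OF q_pos finite_block]
    by (auto simp del: sum.lessThan_Suc)
  finally show ?thesis
    using powr_le_one_iff[OF scaled_norm_nonneg enn2real_exponent_pos[OF q_pos False]] by simp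
qed

lemma mixed_unit_ball_subset_block_ball:
  assumes "q > 0" shows "mixed_unit_ball p q \<alpha> P \<subseteq> block_ball P p 1 \<alpha>"
  using scaled_norm_le_one[OF assms]
  by (fastforce simp: block_ball_def scaled_norm_def powr_minus field_simps)

lemma mixed_unit_ballI:
  assumes q_pos: "q > 0" and w_nonneg_sum_le: "\<And>m. 0 \<le> w m" "\<And>N. (\<Sum>m<N. w m) \<le> 1"
    and scaled_norm_le: "\<And>m. scaled_norm p \<alpha> P x m \<le> w m powr inv_exp q"
  shows "x \<in> mixed_unit_ball p q \<alpha> P"
proof (cases "q = \<infinity>")
  case True
  have "scaled_norm p \<alpha> P x m \<le> 1" for m
    using scaled_norm_le[of m] True by (auto simp: inv_exp_def split: if_splits)
  then show ?thesis unfolding mixed_unit_ball_iff[OF q_pos finite_block] using True by simp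
next
  case False
  have exponent_pos: "0 < enn2real q" using enn2real_exponent_pos[OF q_pos False] .
  have "scaled_norm p \<alpha> P x m powr enn2real q \<le> w m" for m
  proof -
    have "scaled_norm p \<alpha> P x m powr enn2real q \<le> (w m powr inv_exp q) powr enn2real q"
      using exponent_pos by (intro powr_mono2 scaled_norm_le scaled_norm_nonneg) auto
    then show ?thesis
      using exponent_pos w_nonneg_sum_le(1)[of m] False by (simp add: powr_powr inv_exp_def)
  qed
  then have "(\<Sum>m<N. scaled_norm p \<alpha> P x m powr enn2real q) \<le> 1" for N
    using w_nonneg_sum_le(2)[of N] by (meson order_trans sum_mono)
  then show ?thesis using False by (simp add: mixed_unit_ball_iff[OF q_pos finite_block])
qed

end

section \<open>Coverings, codecs and growth orders\<close>

definition l2_coverable :: "('i \<Rightarrow> real) set \<Rightarrow> real \<Rightarrow> real \<Rightarrow> bool" where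
  "l2_coverable S n \<epsilon> \<longleftrightarrow> (\<exists>N. finite N \<and> N \<subseteq> l2space \<and> real (card N) \<le> n \<and>
     (\<forall>x\<in>S. \<exists>y\<in>N. l2dist x y \<le> \<epsilon>))"

lemma l2_coverable_mono:
  assumes "l2_coverable T n \<epsilon>" "S \<subseteq> T" "n \<le> n'" "\<epsilon> \<le> \<epsilon>'"
  shows "l2_coverable S n' \<epsilon>'"
  using assms unfolding l2_coverable_def by (meson order_trans subsetD)

lemma l2_coverable_one:
  assumes S_l2: "S \<subseteq> l2space" and cover: "l2_coverable S n \<epsilon>"
  obtains r where "0 \<le> r" "l2_coverable S 1 r"
proof -
  obtain N where N_net: "finite N" "N \<subseteq> l2space" "\<And>x. x \<in> S \<Longrightarrow> \<exists>y\<in>N. l2dist x y \<le> \<epsilon>"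
    using cover by (auto simp: l2_coverable_def)
  define r where "r = \<bar>\<epsilon>\<bar> + (\<Sum>y\<in>N. l2dist y (\<lambda>_. 0))"
  have "l2dist x (\<lambda>_. 0) \<le> r" if x_in_S: "x \<in> S" for x
  proof -
    obtain y where y_near: "y \<in> N" "l2dist x y \<le> \<epsilon>" using N_net(3)[OF x_in_S] by auto
    have "l2dist x (\<lambda>_. 0) \<le> l2dist x y + l2dist y (\<lambda>_. 0)"
      using S_l2 N_net(2) x_in_S y_near by (intro l2dist_triangle) auto
    also have "\<dots> \<le> r"
      unfolding r_def using y_near N_net(1)
      by (intro add_mono member_le_sum) (auto simp: l2dist_nonneg)
    finally show ?thesis .
  qed
  then have "l2_coverable S 1 r"
    unfolding l2_coverable_def by (intro exI[of _ "{\<lambda>_. 0}"]) auto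
  moreover have "0 \<le> r" by (simp add: r_def sum_nonneg l2dist_nonneg)
  ultimately show ?thesis by (intro that)
qed

lemma finite_bit_strings: "finite {bs :: bool list. length bs = R}"
  using finite_lists_length_eq[of "UNIV :: bool set" R] by simp

lemma card_bit_strings: "card {bs :: bool list. length bs = R} = 2 ^ R"
  using card_lists_length_eq[of "UNIV :: bool set" R] by simp

lemma l2_coverable_iff_code:
  "l2_coverable S (2 ^ R) \<epsilon> \<longleftrightarrow>
    (\<exists>(E :: ('i \<Rightarrow> real) \<Rightarrow> bool list) D. (\<forall>x\<in>S. length (E x) = R) \<and>
      (\<forall>bs. length bs = R \<longrightarrow> D bs \<in> l2space) \<and> (\<forall>x\<in>S. l2dist x (D (E x)) \<le> \<epsilon>))"
proof
  assume "l2_coverable S (2 ^ R) \<epsilon>"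
  then obtain N where N_net: "finite N" "N \<subseteq> l2space" "card N \<le> 2 ^ R"
    and "\<forall>x\<in>S. \<exists>y\<in>N. l2dist x y \<le> \<epsilon>"
    unfolding l2_coverable_def by auto
  then obtain g where g_near: "\<And>x. x \<in> S \<Longrightarrow> g x \<in> N \<and> l2dist x (g x) \<le> \<epsilon>" by metis
  obtain f where f_code: "f ` N \<subseteq> {bs :: bool list. length bs = R}" "inj_on f N"
    using card_le_inj[OF N_net(1) finite_bit_strings[of R]] N_net(3)
    by (auto simp: card_bit_strings)
  have length_f: "length (f y) = R" if "y \<in> N" for y using f_code(1) that by auto
  define D where "D bs = (if bs \<in> f ` N then inv_into N f bs else (\<lambda>_. 0))" for bs
  have "D (f (g x)) = g x" if "x \<in> S" for x using f_code(2) g_near[OF that] by (simp add: D_def)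
  moreover have "D bs \<in> l2space" for bs
    using N_net(2) inv_into_into[of bs f N] by (auto simp: D_def)
  ultimately show "\<exists>(E :: ('i \<Rightarrow> real) \<Rightarrow> bool list) D. (\<forall>x\<in>S. length (E x) = R) \<and>
      (\<forall>bs. length bs = R \<longrightarrow> D bs \<in> l2space) \<and> (\<forall>x\<in>S. l2dist x (D (E x)) \<le> \<epsilon>)"
    using length_f g_near by (intro exI[of _ "\<lambda>x. f (g x)"] exI[of _ D]) auto
next
  assume "\<exists>(E :: ('i \<Rightarrow> real) \<Rightarrow> bool list) D. (\<forall>x\<in>S. length (E x) = R) \<and>
      (\<forall>bs. length bs = R \<longrightarrow> D bs \<in> l2space) \<and> (\<forall>x\<in>S. l2dist x (D (E x)) \<le> \<epsilon>)"
  then obtain E :: "('i \<Rightarrow> real) \<Rightarrow> bool list" and D where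
    length_E: "\<And>x. x \<in> S \<Longrightarrow> length (E x) = R" and D_l2: "\<And>bs. length bs = R \<Longrightarrow> D bs \<in> l2space"
    and error_le: "\<And>x. x \<in> S \<Longrightarrow> l2dist x (D (E x)) \<le> \<epsilon>" by blast
  define N where "N = D ` {bs. length bs = R}"
  have "card N \<le> 2 ^ R"
    unfolding N_def using card_image_le[OF finite_bit_strings, of D R]
    by (simp add: card_bit_strings)
  then show "l2_coverable S (2 ^ R) \<epsilon>"
    unfolding l2_coverable_def using length_E D_l2 error_le finite_bit_strings[of R]
    by (intro exI[of _ N]) (auto simp: N_def)
qed

lemma codec_achieves_iff_l2_coverable:
  "codec_achieves S s \<longleftrightarrow> (\<exists>C. \<forall>R\<ge>1. l2_coverable S (2 ^ R) (C * real R powr (- s)))"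
proof -
  have error: "real R powr s * l2dist x y \<le> C \<longleftrightarrow> l2dist x y \<le> C * real R powr (- s)"
    if "1 \<le> R" for R C and x y :: "'a \<Rightarrow> real"
    using that by (simp add: powr_minus field_simps)
  show ?thesis
  proof
    assume "codec_achieves S s"
    then obtain E :: "nat \<Rightarrow> ('a \<Rightarrow> real) \<Rightarrow> bool list" and D C where
      code: "\<forall>R. \<forall>x\<in>S. length (E R x) = R" "\<forall>R bs. length bs = R \<longrightarrow> D R bs \<in> l2space"
        "\<forall>R\<ge>1. \<forall>x\<in>S. real R powr s * l2dist x (D R (E R x)) \<le> C"
      unfolding codec_achieves_def by (elim exE conjE)
    have "l2_coverable S (2 ^ R) (C * real R powr (- s))" if "1 \<le> R" for R
      unfolding l2_coverable_iff_code
      using code error[OF that] that by (intro exI[of _ "E R"] exI[of _ "D R"]) auto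
    then show "\<exists>C. \<forall>R\<ge>1. l2_coverable S (2 ^ R) (C * real R powr (- s))" by blast
  next
    assume "\<exists>C. \<forall>R\<ge>1. l2_coverable S (2 ^ R) (C * real R powr (- s))"
    then obtain C E D where code: "\<And>R. 1 \<le> R \<Longrightarrow> (\<forall>x\<in>S. length (E R x :: bool list) = R) \<and>
      (\<forall>bs. length bs = R \<longrightarrow> D R bs \<in> l2space) \<and>
      (\<forall>x\<in>S. l2dist x (D R (E R x)) \<le> C * real R powr (- s))"
      unfolding l2_coverable_iff_code by metis
    show "codec_achieves S s"
      unfolding codec_achieves_def
    proof (intro exI conjI allI ballI impI)
      show "length (if R = 0 then [] else E R x) = R" if "x \<in> S" for R x
        using code[of R] that by auto
      show "(if R = 0 then \<lambda>_. 0 else D R bs) \<in> l2space" if "length bs = R" for R bs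
        using code[of R] that by auto
      show "real R powr s * l2dist x (if R = 0 then \<lambda>_. 0 else D R (if R = 0 then [] else E R x)) \<le> C"
        if "1 \<le> R" "x \<in> S" for R x
        using code[of R] error[of R] that by auto
    qed
  qed
qed

lemma codec_achieves_mono:
  assumes "S \<subseteq> T" "codec_achieves T s" shows "codec_achieves S s"
  using assms unfolding codec_achieves_iff_l2_coverable by (meson l2_coverable_mono order_refl)

lemma powr_bracket:
  fixes b x :: real
  assumes "1 < b" "1 \<le> x"
  obtains J :: nat where "b powr real J \<le> x" "x < b powr (real J + 1)"
proof -
  have "\<lfloor>log b x\<rfloor> = int (nat \<lfloor>log b x\<rfloor>)" using assms by simp
  then show ?thesis
    using that[of "nat \<lfloor>log b x\<rfloor>"] assms floor_log_eq_powr_iff[of x b "int (nat \<lfloor>log b x\<rfloor>)"] by simp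
qed

lemma geometric_radius_bracket:
  fixes b c s \<epsilon> :: real
  assumes b_gt_one: "1 < b" and s_pos: "0 < s" and \<epsilon>_bounds: "0 < \<epsilon>" "\<epsilon> \<le> c"
  obtains m :: nat where "\<epsilon> \<le> c * b powr (- s * real m)"
    "c powr (1 / s) * \<epsilon> powr (- 1 / s) \<le> b * b powr real m"
proof -
  have "1 < b powr s" "1 \<le> c / \<epsilon>" using b_gt_one s_pos \<epsilon>_bounds by simp_all
  then obtain m :: nat where
    "(b powr s) powr real m \<le> c / \<epsilon>" "c / \<epsilon> < (b powr s) powr (real m + 1)"
    by (rule powr_bracket)
  then have m_bracket: "b powr (s * real m) \<le> c / \<epsilon>" "c / \<epsilon> < b powr (s * (real m + 1))"
    by (simp_all add: powr_powr)
  have "c powr (1 / s) * \<epsilon> powr (- 1 / s) = (c / \<epsilon>) powr (1 / s)"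
    using \<epsilon>_bounds by (simp add: powr_divide powr_minus field_simps)
  also have "\<dots> \<le> (b powr (s * (real m + 1))) powr (1 / s)"
    using m_bracket(2) \<epsilon>_bounds s_pos by (intro powr_mono2) auto
  also have "\<dots> = b * b powr real m" using b_gt_one s_pos by (simp add: powr_powr powr_add)
  finally have "c powr (1 / s) * \<epsilon> powr (- 1 / s) \<le> b * b powr real m" .
  moreover have "\<epsilon> \<le> c * b powr (- s * real m)"
    using m_bracket(1) \<epsilon>_bounds b_gt_one by (simp add: powr_minus field_simps)
  ultimately show ?thesis by (intro that)
qed

lemma codec_achieves_of_geometric_coverings:
  fixes b s L C :: real
  assumes b_gt_one: "1 < b" and s_pos: "0 < s" and L_pos: "0 < L" and C_nonneg: "0 \<le> C"
    and S_l2: "S \<subseteq> l2space"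
    and cover: "\<And>J::nat. l2_coverable S (2 powr (L * b powr real J)) (C * b powr (- s * real J))"
  shows "codec_achieves S s"
proof -
  obtain r where r_cover: "0 \<le> r" "l2_coverable S 1 r"
    using l2_coverable_one[OF S_l2 cover] by blast
  define K where "K = max (r * L powr s) (C * (L * b) powr s)"
  have "l2_coverable S (2 ^ R) (K * real R powr (- s))" if R_ge_one: "1 \<le> R" for R :: nat
  proof (cases "real R < L")
    case True
    have "1 \<le> L powr s * real R powr (- s)"
      using True s_pos R_ge_one powr_mono2[of s "real R" L] by (simp add: powr_minus field_simps)
    then have "r * 1 \<le> r * (L powr s * real R powr (- s))" using r_cover(1) by (rule mult_left_mono)
    also have "\<dots> = r * L powr s * real R powr (- s)" by (simp only: mult_ac)
    also have "\<dots> \<le> K * real R powr (- s)" unfolding K_def by (intro mult_right_mono) auto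
    finally show ?thesis by (intro l2_coverable_mono[OF r_cover(2)]) auto
  next
    case False
    then obtain J :: nat where J_bracket: "b powr real J \<le> real R / L" "real R / L < b powr (real J + 1)"
      using powr_bracket[OF b_gt_one, of "real R / L"] L_pos by auto
    have "2 powr (L * b powr real J) \<le> 2 powr real R"
      using J_bracket(1) L_pos by (intro powr_mono) (auto simp: field_simps)
    then have bits: "2 powr (L * b powr real J) \<le> 2 ^ R" by (simp add: powr_realpow)
    have "real R \<le> L * b * b powr real J"
      using J_bracket(2) L_pos b_gt_one by (simp add: powr_add field_simps)
    then have "(L * b * b powr real J) powr (- s) \<le> real R powr (- s)"
      using s_pos R_ge_one by (intro powr_mono2') auto
    then have "(L * b) powr (- s) * b powr (- s * real J) \<le> real R powr (- s)"
      by (simp add: powr_mult powr_powr mult.commute)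
    then have "b powr (- s * real J) \<le> (L * b) powr s * real R powr (- s)"
      using L_pos b_gt_one by (simp add: powr_minus field_simps)
    then have "C * b powr (- s * real J) \<le> C * ((L * b) powr s * real R powr (- s))"
      using C_nonneg by (intro mult_left_mono)
    also have "\<dots> = C * (L * b) powr s * real R powr (- s)" by (simp only: mult_ac)
    also have "\<dots> \<le> K * real R powr (- s)" unfolding K_def by (intro mult_right_mono) auto
    finally show ?thesis using bits by (intro l2_coverable_mono[OF cover[of J]]) auto
  qed
  then show ?thesis unfolding codec_achieves_iff_l2_coverable by blast
qed

lemma one_le_covering_mult_ball_measure:
  assumes prob_M: "borel_prob_on S M" and S_l2: "S \<subseteq> l2space" and cover: "l2_coverable S n \<epsilon>"
    and ball_le: "\<And>x. x \<in> l2space \<Longrightarrow> measure M (S \<inter> {y\<in>l2space. l2dist x y \<le> \<epsilon>}) \<le> v"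
  shows "1 \<le> n * v"
proof -
  interpret prob_space M using prob_M by (simp add: borel_prob_on_def)
  define B where "B y = S \<inter> {z\<in>l2space. l2dist y z \<le> \<epsilon>}" for y
  obtain N where N_net: "finite N" "N \<subseteq> l2space" "real (card N) \<le> n" "\<And>x. x \<in> S \<Longrightarrow> \<exists>y\<in>N. l2dist x y \<le> \<epsilon>"
    using cover by (auto simp: l2_coverable_def)
  have ball_in_sets: "B y \<in> sets M" if "y \<in> N" for y
    using prob_M closed_ball_sets_l2borel[of y \<epsilon>] that N_net(2)
    by (auto simp: borel_prob_on_def sets_restrict_space B_def)
  have "space M \<subseteq> (\<Union>y\<in>N. B y)"
    using prob_M S_l2 N_net(4) by (fastforce simp: borel_prob_on_def B_def l2.commute)
  then have "measure M (space M) \<le> measure M (\<Union>y\<in>N. B y)"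
    using N_net(1) ball_in_sets by (intro finite_measure_mono sets.finite_UN)
  then have "1 \<le> measure M (\<Union>y\<in>N. B y)" by (simp add: prob_space)
  also have "\<dots> \<le> (\<Sum>y\<in>N. measure M (B y))"
    using N_net(1) ball_in_sets by (intro finite_measure_subadditive_finite) auto
  also have "\<dots> \<le> (\<Sum>y\<in>N. v)" unfolding B_def using N_net(2) by (intro sum_mono ball_le) auto
  also have "\<dots> = real (card N) * v" by simp
  also have "\<dots> \<le> n * v"
    using N_net(3) order_trans[OF measure_nonneg ball_le[OF zero_in_l2space]]
    by (rule mult_right_mono)
  finally show ?thesis .
qed

lemma covering_bits_ge:
  assumes prob_M: "borel_prob_on S M" and S_l2: "S \<subseteq> l2space" and cover: "l2_coverable S (2 ^ R) \<epsilon>"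
    and small: "\<And>x. x \<in> l2space \<Longrightarrow> measure M (S \<inter> {y\<in>l2space. l2dist x y \<le> \<epsilon>}) \<le> 2 powr (- v)"
  shows "v \<le> real R"
proof -
  have "1 \<le> 2 ^ R * 2 powr (- v)"
    by (rule one_le_covering_mult_ball_measure[OF prob_M S_l2 cover small])
  then have "2 powr 0 \<le> 2 powr (real R - v)"
    by (simp add: powr_diff powr_minus powr_realpow field_simps)
  then show ?thesis by (subst (asm) powr_le_cancel_iff) auto
qed

lemma codec_rate_le_growth_order:
  assumes prob_M: "borel_prob_on S M" and S_l2: "S \<subseteq> l2space" and growth: "growth_order S M s0"
    and s0_nonneg: "0 \<le> s0" and codec: "codec_achieves S s"
  shows "s \<le> s0"
proof (rule ccontr)
  assume "\<not> s \<le> s0"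
  then obtain t where t_between: "s0 < t" "t < s" by (meson dense not_le)
  obtain \<epsilon>0 c where \<epsilon>0_pos: "0 < \<epsilon>0" and c_pos: "0 < c" and
    small: "\<And>x \<epsilon>. x \<in> l2space \<Longrightarrow> 0 < \<epsilon> \<Longrightarrow> \<epsilon> < \<epsilon>0 \<Longrightarrow>
      measure M (S \<inter> {y\<in>l2space. l2dist x y \<le> \<epsilon>}) \<le> 2 powr (- c * \<epsilon> powr (- 1 / t))"
    using growth[unfolded growth_order_def, THEN spec, THEN mp, OF t_between(1)] by blast
  obtain C0 where cover0: "\<And>R. 1 \<le> R \<Longrightarrow> l2_coverable S (2 ^ R) (C0 * real R powr (- s))"
    using codec unfolding codec_achieves_iff_l2_coverable by blast
  define C where "C = max C0 1"
  have C_pos: "0 < C" by (simp add: C_def)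
  have cover: "l2_coverable S (2 ^ R) (C * real R powr (- s))" if "1 \<le> R" for R
    by (rule l2_coverable_mono[OF cover0[OF that]]) (auto simp: C_def mult_right_mono)
  define k where "k = c * C powr (- 1 / t)"
  have bits_lower_bound: "k \<le> real R powr (1 - s / t)"
    if R_ge_one: "1 \<le> R" and \<epsilon>_small: "C * real R powr (- s) < \<epsilon>0" for R
  proof -
    define \<epsilon> where "\<epsilon> = C * real R powr (- s)"
    have "0 < \<epsilon>" "\<epsilon> < \<epsilon>0" using R_ge_one \<epsilon>_small C_pos by (auto simp: \<epsilon>_def)
    then have "c * \<epsilon> powr (- 1 / t) \<le> real R"
      using small unfolding \<epsilon>_def
      by (intro covering_bits_ge[OF prob_M S_l2 cover[OF R_ge_one]]) auto
    moreover have "\<epsilon> powr (- 1 / t) = C powr (- 1 / t) * real R powr (s / t)"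
      using C_pos R_ge_one by (simp add: \<epsilon>_def powr_mult powr_powr)
    ultimately have "k * real R powr (s / t) \<le> real R" by (simp add: k_def mult.assoc)
    then show ?thesis using R_ge_one by (simp add: powr_diff field_simps)
  qed
  have "(\<lambda>R. C * real R powr (- s)) \<longlonglongrightarrow> C * 0"
    using s0_nonneg t_between
    by (intro tendsto_mult_left tendsto_neg_powr filterlim_real_sequentially) auto
  then have "\<forall>\<^sub>F R in sequentially. C * real R powr (- s) < \<epsilon>0"
    using \<epsilon>0_pos by (intro order_tendstoD) auto
  moreover have "(\<lambda>R. real R powr (1 - s / t)) \<longlonglongrightarrow> 0"
    using s0_nonneg t_between by (intro tendsto_neg_powr filterlim_real_sequentially) auto
  then have "\<forall>\<^sub>F R in sequentially. real R powr (1 - s / t) < k"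
    using c_pos C_pos by (intro order_tendstoD) (auto simp: k_def)
  ultimately have "\<forall>\<^sub>F R in sequentially. False"
    using eventually_ge_at_top[of 1] by eventually_elim (use bits_lower_bound in force)
  then show False by simp
qed

lemma opt_rate_eqI:
  assumes prob_M: "borel_prob_on S M" and S_l2: "S \<subseteq> l2space" and growth: "growth_order S M s0"
    and s0_pos: "0 < s0" and codec: "\<And>s. 0 < s \<Longrightarrow> s < s0 \<Longrightarrow> codec_achieves S s"
  shows "opt_rate S = ereal s0"
  unfolding opt_rate_def
proof (rule antisym)
  show "Sup (ereal ` {s. 0 \<le> s \<and> codec_achieves S s}) \<le> ereal s0"
    using codec_rate_le_growth_order[OF prob_M S_l2 growth] s0_pos by (auto intro!: Sup_least)
  show "ereal s0 \<le> Sup (ereal ` {s. 0 \<le> s \<and> codec_achieves S s})"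
  proof (rule dense_le_bounded[of 0])
    show "(0::ereal) < ereal s0" using s0_pos by simp
    show "w \<le> Sup (ereal ` {s. 0 \<le> s \<and> codec_achieves S s})" if "0 < w" "w < ereal s0" for w
      using that codec by (cases w) (auto intro!: Sup_upper)
  qed
qed

lemma growth_order_of_geometric_radii:
  fixes b \<kappa> s0 :: real and \<rho> :: "nat \<Rightarrow> real"
  assumes b_gt_one: "1 < b" and \<kappa>_pos: "0 < \<kappa>" and s0_nonneg: "0 \<le> s0"
    and small: "\<And>x \<epsilon> m. x \<in> l2space \<Longrightarrow> 0 \<le> \<epsilon> \<Longrightarrow> \<epsilon> \<le> \<rho> m \<Longrightarrow>
      measure M (S \<inter> {y\<in>l2space. l2dist x y \<le> \<epsilon>}) \<le> exp (- \<kappa> * b powr real m)"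
    and \<rho>_ge: "\<And>s. s0 < s \<Longrightarrow> \<exists>c>0. \<forall>m. c * b powr (- s * real m) \<le> \<rho> m"
  shows "growth_order S M s0"
  unfolding growth_order_def
proof (intro allI impI)
  fix s assume "s0 < s"
  then have s_pos: "0 < s" using s0_nonneg by simp
  obtain c where c_pos: "0 < c" and c_le: "\<And>m. c * b powr (- s * real m) \<le> \<rho> m"
    using \<rho>_ge[OF \<open>s0 < s\<close>] by blast
  define k where "k = \<kappa> * c powr (1 / s) / (b * ln 2)"
  have "measure M (S \<inter> {y\<in>l2space. l2dist x y \<le> \<epsilon>}) \<le> 2 powr (- k * \<epsilon> powr (- 1 / s))"
    if x_l2: "x \<in> l2space" and \<epsilon>_bounds: "0 < \<epsilon>" "\<epsilon> < c" for x \<epsilon>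
  proof -
    obtain m :: nat where m_bracket: "\<epsilon> \<le> c * b powr (- s * real m)"
      "c powr (1 / s) * \<epsilon> powr (- 1 / s) \<le> b * b powr real m"
      by (rule geometric_radius_bracket[OF b_gt_one s_pos \<epsilon>_bounds(1) less_imp_le[OF \<epsilon>_bounds(2)]])
    have "\<epsilon> \<le> \<rho> m" using m_bracket(1) c_le[of m] by linarith
    then have "measure M (S \<inter> {y\<in>l2space. l2dist x y \<le> \<epsilon>}) \<le> exp (- \<kappa> * b powr real m)"
      using x_l2 \<epsilon>_bounds by (intro small) auto
    also have "\<dots> \<le> exp (- \<kappa> * (c powr (1 / s) * \<epsilon> powr (- 1 / s) / b))"
      using m_bracket(2) \<kappa>_pos b_gt_one by (simp add: field_simps)
    also have "\<dots> = 2 powr (- k * \<epsilon> powr (- 1 / s))" by (simp add: powr_def k_def field_simps)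
    finally show ?thesis .
  qed
  moreover have "0 < k" using \<kappa>_pos c_pos b_gt_one by (simp add: k_def)
  ultimately show "\<exists>\<epsilon>0>0. \<exists>c>0. \<forall>x\<in>l2space. \<forall>\<epsilon>. 0 < \<epsilon> \<and> \<epsilon> < \<epsilon>0 \<longrightarrow>
      measure M (S \<inter> {y\<in>l2space. l2dist x y \<le> \<epsilon>}) \<le> 2 powr (- c * \<epsilon> powr (- 1 / s))"
    using c_pos by blast
qed

section \<open>Sparse vectors on a grid\<close>

definition sparse_grid :: "real \<Rightarrow> int \<Rightarrow> 'i set \<Rightarrow> nat \<Rightarrow> ('i \<Rightarrow> real) set" where
  "sparse_grid h g F k = {z. {i. z i \<noteq> 0} \<subseteq> F \<and> card {i. z i \<noteq> 0} \<le> k \<and>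
     (\<forall>i. \<exists>q. \<bar>q\<bar> \<le> g \<and> z i = h * of_int q)}"

lemma sparse_grid_subset_l2space: "finite F \<Longrightarrow> sparse_grid h g F k \<subseteq> l2space"
  by (auto simp: sparse_grid_def intro: l2space_finite_support finite_subset)

lemma sparse_grid_Suc_subset:
  assumes finite_F: "finite F"
  shows "sparse_grid h g F (Suc k) \<subseteq> sparse_grid h g F k \<union>
    (\<lambda>(z, i, q). z(i := h * of_int q)) ` (sparse_grid h g F k \<times> F \<times> {- g..g})"
proof
  fix z assume z_grid: "z \<in> sparse_grid h g F (Suc k)"
  let ?supp = "{i. z i \<noteq> 0}"
  show "z \<in> sparse_grid h g F k \<union>
    (\<lambda>(z, i, q). z(i := h * of_int q)) ` (sparse_grid h g F k \<times> F \<times> {- g..g})"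
  proof (cases "?supp = {}")
    case True
    then show ?thesis using z_grid by (auto simp: sparse_grid_def)
  next
    case False
    then obtain i where z_i: "z i \<noteq> 0" by auto
    obtain q where q_level: "\<bar>q\<bar> \<le> g" "z i = h * of_int q"
      using z_grid by (auto simp: sparse_grid_def)
    have "finite ?supp" using z_grid finite_F finite_subset by (auto simp: sparse_grid_def)
    moreover have "{j. (z(i := 0)) j \<noteq> 0} = ?supp - {i}" by auto
    ultimately have "card {j. (z(i := 0)) j \<noteq> 0} \<le> k"
      using z_grid z_i by (auto simp: sparse_grid_def)
    moreover have "\<exists>q'. \<bar>q'\<bar> \<le> g \<and> (z(i := 0)) j = h * of_int q'" for j
      using z_grid q_level(1) by (cases "j = i") (auto simp: sparse_grid_def intro!: exI[of _ 0])
    ultimately have "z(i := 0) \<in> sparse_grid h g F k" using z_grid by (auto simp: sparse_grid_def)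
    moreover have "i \<in> F" using z_grid z_i by (auto simp: sparse_grid_def)
    moreover have "z = (z(i := 0))(i := h * of_int q)" using q_level(2) by auto
    ultimately show ?thesis
      using q_level(1) by (intro UnI2 image_eqI[of _ _ "(z(i := 0), i, q)"]) auto
  qed
qed

lemma sparse_grid_0_subset: "finite F \<Longrightarrow> sparse_grid h g F 0 \<subseteq> {\<lambda>_. 0}"
  by (auto simp: sparse_grid_def card_eq_0_iff intro: finite_subset)

lemma finite_sparse_grid:
  assumes finite_F: "finite F" shows "finite (sparse_grid h g F k)"
proof (induction k)
  case 0
  then show ?case using finite_subset[OF sparse_grid_0_subset[OF finite_F]] by simp
next
  case (Suc k)
  then show ?case
    using finite_F by (intro finite_subset[OF sparse_grid_Suc_subset[OF finite_F]]) auto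
qed

lemma card_sparse_grid_le:
  assumes finite_F: "finite F"
  shows "card (sparse_grid h g F k) \<le> (card F * card {- g..g} + 1) ^ k"
proof (induction k)
  case 0
  then show ?case using card_mono[OF _ sparse_grid_0_subset[OF finite_F]] by force
next
  case (Suc k)
  let ?G = "sparse_grid h g F"
  let ?update = "(\<lambda>(z, i, q). z(i := h * of_int q)) ` (?G k \<times> F \<times> {- g..g})"
  have finite_updates: "finite (?G k \<times> F \<times> {- g..g})"
    using finite_sparse_grid[OF finite_F] finite_F by simp
  have "card (?G (Suc k)) \<le> card (?G k \<union> ?update)"
    using finite_updates finite_sparse_grid[OF finite_F]
    by (intro card_mono sparse_grid_Suc_subset[OF finite_F]) auto
  also have "\<dots> \<le> card (?G k) + card ?update" by (rule card_Un_le)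
  also have "\<dots> \<le> card (?G k) + card (?G k) * (card F * card {- g..g})"
    using card_image_le[OF finite_updates] by (simp add: card_cartesian_product)
  also have "\<dots> = card (?G k) * (card F * card {- g..g} + 1)" by (simp add: algebra_simps)
  also have "\<dots> \<le> (card F * card {- g..g} + 1) ^ k * (card F * card {- g..g} + 1)"
    using Suc by (intro mult_right_mono) auto
  finally show ?case by (simp add: mult.commute)
qed

lemma floor_in_sparse_grid:
  assumes W_support: "finite W" "W \<subseteq> F" "card W \<le> k" and h_pos: "0 < h"
    and x_le: "\<And>i. i \<in> W \<Longrightarrow> \<bar>x i\<bar> \<le> h * of_int g" and g_nonneg: "0 \<le> g"
  shows "(\<lambda>i. if i \<in> W then h * of_int \<lfloor>x i / h\<rfloor> else 0) \<in> sparse_grid h g F k" (is "?z \<in> _")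
proof -
  have support_subset: "{i. ?z i \<noteq> 0} \<subseteq> W" by auto
  have "\<bar>\<lfloor>x i / h\<rfloor>\<bar> \<le> g" if "i \<in> W" for i
  proof -
    have "\<bar>x i / h\<bar> \<le> of_int g" using x_le[OF that] h_pos by (simp add: field_simps)
    then have "of_int (- g) \<le> x i / h" "x i / h < of_int g + 1" unfolding abs_le_iff by auto
    then show ?thesis by (simp add: abs_le_iff le_floor_iff floor_le_iff minus_le_iff)
  qed
  then have "\<exists>q. \<bar>q\<bar> \<le> g \<and> ?z i = h * of_int q" for i
    using g_nonneg by (cases "i \<in> W") (auto intro: exI[of _ 0] exI[of _ "\<lfloor>x i / h\<rfloor>"])
  then show ?thesis
    using support_subset W_support card_mono[OF W_support(1) support_subset]
    by (auto simp: sparse_grid_def)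
qed

lemma l2dist_floor_le:
  assumes finite_W: "finite W" and h_pos: "0 < h"
  shows "l2dist (\<lambda>i. if i \<in> W then x i else 0) (\<lambda>i. if i \<in> W then h * of_int \<lfloor>x i / h\<rfloor> else 0)
    \<le> h * sqrt (real (card W))" (is "l2dist ?x ?z \<le> _")
proof -
  have "?x \<in> l2space" "?z \<in> l2space"
    using finite_W by (auto intro: l2space_restrict)
  moreover have "L2_set (\<lambda>i. ?x i - ?z i) F \<le> h * sqrt (real (card W))" if finite_F: "finite F" for F
  proof -
    have "(?x i - ?z i)\<^sup>2 \<le> (if i \<in> W then h\<^sup>2 else 0)" for i
    proof -
      define q where "q = \<lfloor>x i / h\<rfloor>"
      have "of_int q \<le> x i / h" "x i / h \<le> of_int q + 1" unfolding q_def by linarith+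
      then have "h * of_int q \<le> x i" "x i \<le> h * of_int q + h"
        using h_pos by (auto simp: field_simps)
      then show ?thesis using h_pos by (auto intro!: power_mono simp flip: q_def)
    qed
    then have "(\<Sum>i\<in>F. (?x i - ?z i)\<^sup>2) \<le> (\<Sum>i\<in>F. if i \<in> W then h\<^sup>2 else 0)" by (rule sum_mono)
    also have "\<dots> = real (card (F \<inter> W)) * h\<^sup>2" using finite_F by (simp add: sum.If_cases)
    also have "\<dots> \<le> real (card W) * h\<^sup>2"
      using finite_W by (intro mult_right_mono) (auto intro: card_mono)
    also have "\<dots> = (h * sqrt (real (card W)))\<^sup>2" by (simp add: power_mult_distrib)
    finally show ?thesis using h_pos unfolding L2_set_def by (intro real_le_lsqrt sum_nonneg) auto
  qed
  ultimately show ?thesis by (simp add: l2dist_le_iff)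
qed

section \<open>Exponential growth and decay\<close>

lemma summable_two_powr:
  assumes "0 < (\<gamma>::real)" shows "summable (\<lambda>m. 2 powr (- \<gamma> * real m))"
proof -
  have "(2::real) powr (- \<gamma>) < 2 powr 0" using assms by (intro powr_less_mono) auto
  then have "summable (\<lambda>m. (2 powr (- \<gamma>)) ^ m)" by (intro summable_geometric) simp
  moreover have "(2 powr (- \<gamma>)) ^ m = 2 powr (- \<gamma> * real m)" for m
    by (simp add: powr_power mult.commute)
  ultimately show ?thesis by simp
qed

definition geometric_tail :: "real \<Rightarrow> nat \<Rightarrow> real \<Rightarrow> nat \<Rightarrow> real" where
  "geometric_tail \<gamma> n w m = (if m < n then 0 else w * 2 powr (- \<gamma> * real m))"

lemma suminf_two_powr_nonneg: "0 < \<gamma> \<Longrightarrow> 0 \<le> (\<Sum>m. 2 powr (- \<gamma> * real m))"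
  using summable_two_powr[of \<gamma>] by (intro suminf_nonneg) auto

lemma geometric_tail_sums:
  fixes \<gamma> w :: real assumes "0 < \<gamma>"
  shows "geometric_tail \<gamma> n w sums (w * 2 powr (- \<gamma> * real n) * (\<Sum>m. 2 powr (- \<gamma> * real m)))"
proof -
  have "(\<lambda>m. (w * 2 powr (- \<gamma> * real n)) * 2 powr (- \<gamma> * real m)) sums
    (w * 2 powr (- \<gamma> * real n) * (\<Sum>m. 2 powr (- \<gamma> * real m)))"
    by (intro sums_mult summable_sums summable_two_powr assms)
  also have "(\<lambda>m. (w * 2 powr (- \<gamma> * real n)) * 2 powr (- \<gamma> * real m)) =
      (\<lambda>m. geometric_tail \<gamma> n w (m + n))"
  proof
    fix m
    have "- \<gamma> * real (m + n) = - \<gamma> * real n + - \<gamma> * real m" by (simp add: algebra_simps)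
    then show "(w * 2 powr (- \<gamma> * real n)) * 2 powr (- \<gamma> * real m) = geometric_tail \<gamma> n w (m + n)"
      unfolding geometric_tail_def by (simp only: powr_add) simp
  qed
  finally show ?thesis by (subst (asm) sums_iff_shift) (simp add: geometric_tail_def)
qed

lemma powr_mult_exponential_le:
  fixes k u v :: real assumes "v < u"
  obtains K where "0 < K"
    "\<And>n::nat. (real n + 1) powr k * 2 powr (v * real n) \<le> K * 2 powr (u * real n)"
proof -
  define w where "w = u - v"
  have "0 < w" using assms by (simp add: w_def)
  then have "(\<lambda>n::nat. (real n + 1) powr k * 2 powr (- w * real n)) \<longlonglongrightarrow> 0" by real_asymp
  then have "Bseq (\<lambda>n::nat. (real n + 1) powr k * 2 powr (- w * real n))"
    by (intro convergent_imp_Bseq convergentI)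
  then obtain K where K_bound: "0 < K" "\<And>n::nat. norm ((real n + 1) powr k * 2 powr (- w * real n)) \<le> K"
    by (auto elim: BseqE)
  have "(real n + 1) powr k * 2 powr (v * real n) \<le> K * 2 powr (u * real n)" for n :: nat
  proof -
    have "v * real n = - w * real n + u * real n" by (simp add: w_def algebra_simps)
    then have "(real n + 1) powr k * 2 powr (v * real n) =
        (real n + 1) powr k * 2 powr (- w * real n) * 2 powr (u * real n)"
      by (simp only: powr_add mult.assoc)
    also have "\<dots> \<le> K * 2 powr (u * real n)" using K_bound(2)[of n] by (intro mult_right_mono) auto
    finally show ?thesis .
  qed
  then show ?thesis using K_bound(1) that by blast
qed

lemma two_power_mult: "(2::real) ^ (d * m) = 2 powr (real d * real m)"
  by (simp add: powr_realpow flip: of_nat_mult)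

lemma codec_achieves_of_quadratic_coverings:
  fixes d L :: nat and s \<sigma> D :: real
  assumes d_ge_one: "1 \<le> d" and s_pos: "0 < s" and s_less: "s < \<sigma> / real d"
    and L_ge_one: "1 \<le> L" and D_nonneg: "0 \<le> D" and S_l2: "S \<subseteq> l2space"
    and cover: "\<And>J. l2_coverable S (2 ^ (L * (J + 1)\<^sup>2 * 2 ^ (d * J))) (D * 2 powr (- \<sigma> * real J))"
  shows "codec_achieves S s"
proof -
  have d_less: "real d < \<sigma> / s" using s_pos s_less d_ge_one by (simp add: field_simps)
  obtain M where M_bound: "0 < M"
    "\<And>n::nat. (real n + 1) powr 2 * 2 powr (real d * real n) \<le> M * 2 powr (\<sigma> / s * real n)"
    using powr_mult_exponential_le[OF d_less, of 2] by blast
  define b where "b = (2::real) powr (\<sigma> / s)"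
  show ?thesis
  proof (rule codec_achieves_of_geometric_coverings)
    have "0 < \<sigma> / s" using d_less d_ge_one by linarith
    then show "1 < b" by (simp add: b_def)
    show "0 < real L * M" using L_ge_one M_bound by simp
    fix J :: nat
    have "real (L * (J + 1)\<^sup>2 * 2 ^ (d * J)) =
        real L * ((real J + 1) powr 2 * 2 powr (real d * real J))"
      by (simp add: two_power_mult add.commute)
    also have "\<dots> \<le> real L * (M * 2 powr (\<sigma> / s * real J))"
      by (intro mult_left_mono M_bound(2)) simp
    also have "\<dots> = real L * M * b powr real J" by (simp add: b_def powr_powr)
    finally have "2 powr real (L * (J + 1)\<^sup>2 * 2 ^ (d * J)) \<le> 2 powr (real L * M * b powr real J)"
      by (rule powr_mono) simp
    then have bits: "(2::real) ^ (L * (J + 1)\<^sup>2 * 2 ^ (d * J)) \<le> 2 powr (real L * M * b powr real J)"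
      by (subst (asm) powr_realpow) auto
    have "D * 2 powr (- \<sigma> * real J) = D * b powr (- s * real J)"
      using s_pos by (simp add: b_def powr_powr)
    then show "l2_coverable S (2 powr (real L * M * b powr real J)) (D * b powr (- s * real J))"
      using bits by (intro l2_coverable_mono[OF cover[of J]]) auto
  qed (fact s_pos D_nonneg S_l2)+
qed

section \<open>Codecs for regular partitions\<close>

lemma (in finite_blocks) block_ball_two_subset_block_dominated:
  "block_ball P 2 C \<beta> \<subseteq> block_dominated (\<lambda>m. C\<^sup>2 * 2 powr (- (2 * \<beta>) * real m))"
proof
  fix x assume x_ball: "x \<in> block_ball P 2 C \<beta>"
  have "(\<Sum>i\<in>P m. (x i)\<^sup>2) \<le> C\<^sup>2 * 2 powr (- (2 * \<beta>) * real m)" for m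
  proof -
    have "L2_set x (P m) \<le> C * 2 powr (- \<beta> * real m)"
      using x_ball by (simp add: block_ball_def lp_norm_fin_two)
    then have "(\<Sum>i\<in>P m. (x i)\<^sup>2) \<le> (C * 2 powr (- \<beta> * real m))\<^sup>2"
      unfolding L2_set_def by (rule sqrt_le_D)
    then show ?thesis by (simp add: power_mult_distrib powr_power algebra_simps)
  qed
  then show "x \<in> block_dominated (\<lambda>m. C\<^sup>2 * 2 powr (- (2 * \<beta>) * real m))"
    by (simp add: block_dominated_def)
qed

lemma (in finite_blocks) block_ball_subset_block_dominated_small_exponent:
  assumes "0 < p" "p \<le> 2"
  shows "block_ball P p C \<beta> \<subseteq> block_dominated (\<lambda>m. C\<^sup>2 * 2 powr (- (2 * \<beta>) * real m))"
proof -
  have "block_ball P p C \<beta> \<subseteq> block_ball P 2 C \<beta>"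
    using L2_set_le_lp_norm_fin_small_exponent[OF assms finite_block]
    by (auto simp: block_ball_def lp_norm_fin_two intro: order_trans)
  then show ?thesis using block_ball_two_subset_block_dominated by (rule subset_trans)
qed

lemma (in finite_blocks) block_ball_subset_l2space_small_exponent:
  assumes "0 < p" "p \<le> 2" "0 < \<beta>"
  shows "block_ball P p C \<beta> \<subseteq> l2space"
proof -
  have "summable (\<lambda>m. C\<^sup>2 * 2 powr (- (2 * \<beta>) * real m))"
    using assms(3) by (intro summable_mult summable_two_powr) simp
  then show ?thesis
    using block_ball_subset_block_dominated_small_exponent[OF assms(1,2)]
      block_dominated_subset_l2space by (meson subset_trans)
qed

lemma (in finite_blocks) block_ball_abs_le:
  assumes "x \<in> block_ball P p C \<beta>" "0 < p" "0 \<le> C" "0 \<le> \<beta>"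
  shows "\<bar>x i\<bar> \<le> C"
proof -
  obtain m where i_in_block: "i \<in> P m" using blocks_cover by (metis UNIV_I UN_E)
  have "\<bar>x i\<bar> \<le> lp_norm_fin p (P m) x"
    by (rule abs_le_lp_norm_fin[OF assms(2) finite_block i_in_block])
  also have "\<dots> \<le> C * 2 powr (- \<beta> * real m)" using assms(1) by (simp add: block_ball_def)
  also have "\<dots> \<le> C * 2 powr 0" using assms(3,4) by (intro mult_left_mono powr_mono) auto
  finally show ?thesis by simp
qed

locale regular_blocks = finite_blocks P for P :: "nat \<Rightarrow> 'i set" +
  fixes d :: nat and a :: real and A :: nat
  assumes d_pos: "1 \<le> d" and a_pos: "0 < a"
    and card_ge: "a * 2 ^ (d * m) \<le> real (card (P m))"
    and card_le: "card (P m) \<le> A * 2 ^ (d * m)"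
begin

lemma card_block_pos: "0 < card (P m)"
proof -
  have "0 < a * 2 ^ (d * m)" using a_pos by simp
  then show ?thesis using card_ge[of m] by linarith
qed

lemma A_pos: "1 \<le> A"
  using card_le[of 0] card_block_pos[of 0] by simp

lemma card_block_le_powr: "real (card (P m)) \<le> real A * 2 powr (real d * real m)"
proof -
  have "real (card (P m)) \<le> real (A * 2 ^ (d * m))" by (simp only: of_nat_le_iff card_le)
  then show ?thesis by (simp add: two_power_mult)
qed

lemma block_ball_subset_block_ball_two:
  assumes p_pos: "0 < p"
  defines "\<theta> \<equiv> max 0 (1/2 - inv_exp p)"
  shows "block_ball P p C \<beta> \<subseteq> block_ball P 2 (real A powr \<theta> * C) (\<beta> - real d * \<theta>)"
proof
  fix x assume x_ball: "x \<in> block_ball P p C \<beta>"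
  have "L2_set x (P m) \<le> real A powr \<theta> * C * 2 powr (- (\<beta> - real d * \<theta>) * real m)" for m
  proof -
    have "L2_set x (P m) \<le> real (card (P m)) powr \<theta> * lp_norm_fin p (P m) x"
      unfolding \<theta>_def by (rule L2_set_le_lp_norm_fin[OF p_pos finite_block])
    also have "\<dots> \<le> (real A * 2 powr (real d * real m)) powr \<theta> * (C * 2 powr (- \<beta> * real m))"
      using x_ball
      by (intro mult_mono powr_mono2 card_block_le_powr lp_norm_fin_nonneg finite_block)
        (auto simp: block_ball_def \<theta>_def)
    also have "\<dots> = real A powr \<theta> * C * 2 powr (real d * real m * \<theta> + - \<beta> * real m)"
      unfolding powr_add by (simp add: powr_mult powr_powr)
    also have "real d * real m * \<theta> + - \<beta> * real m = - (\<beta> - real d * \<theta>) * real m"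
      by (simp add: algebra_simps)
    finally show ?thesis .
  qed
  then show "x \<in> block_ball P 2 (real A powr \<theta> * C) (\<beta> - real d * \<theta>)"
    by (simp add: block_ball_def lp_norm_fin_two)
qed

lemma block_ball_subset_block_dominated:
  assumes p_pos: "0 < p" and \<beta>_gt: "real d * max 0 (1/2 - inv_exp p) < \<beta>"
  obtains c where "summable c" "block_ball P p C \<beta> \<subseteq> block_dominated c"
proof
  define \<theta> where "\<theta> = max 0 (1/2 - inv_exp p)"
  define \<gamma> where "\<gamma> = 2 * (\<beta> - real d * \<theta>)"
  show "summable (\<lambda>m. (real A powr \<theta> * C)\<^sup>2 * 2 powr (- \<gamma> * real m))"
    using \<beta>_gt by (intro summable_mult summable_two_powr) (simp add: \<gamma>_def \<theta>_def)
  show "block_ball P p C \<beta> \<subseteq> block_dominated (\<lambda>m. (real A powr \<theta> * C)\<^sup>2 * 2 powr (- \<gamma> * real m))"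
    unfolding \<gamma>_def \<theta>_def
    using block_ball_subset_block_ball_two[OF p_pos] block_ball_two_subset_block_dominated
    by (rule subset_trans)
qed

lemma block_ball_sparse_block:
  assumes x_ball: "x \<in> block_ball P p C \<beta>" and p_bounds: "0 < p" "p \<le> 2" and C_pos: "0 < C"
  obtains W where "W \<subseteq> P m" "card W \<le> A * 2 ^ (d * J)"
    "(\<Sum>i\<in>P m - W. (x i)\<^sup>2) \<le>
      geometric_tail (2 * \<beta>) J (C\<^sup>2 * 2 powr (real d * real J * (1 - 2 * inv_exp p))) m"
proof (cases "m < J")
  case True
  have "card (P m) \<le> A * 2 ^ (d * m)" by (rule card_le)
  also have "\<dots> \<le> A * 2 ^ (d * J)" using True by (intro mult_left_mono power_increasing) auto
  finally show ?thesis using True by (intro that[of "P m"]) (auto simp: geometric_tail_def)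
next
  case False
  define c where "c = C * 2 powr (- \<beta> * real m)"
  have "lp_norm_fin p (P m) x \<le> c" "0 < c" using x_ball C_pos by (auto simp: block_ball_def c_def)
  then obtain W where W_sparse: "W \<subseteq> P m" "real (card W) \<le> 2 powr (real d * real J)"
    "(\<Sum>i\<in>P m - W. (x i)\<^sup>2) \<le> c\<^sup>2 * (2 powr (real d * real J)) powr (1 - 2 * inv_exp p)"
    using stechkin_sparse_approximation[OF p_bounds finite_block, of m x c "2 powr (real d * real J)"]
    by auto
  have "real (card W) \<le> real (2 ^ (d * J))" using W_sparse(2) by (simp add: two_power_mult)
  then have "card W \<le> 2 ^ (d * J)" by (simp only: of_nat_le_iff)
  also have "\<dots> \<le> A * 2 ^ (d * J)" using A_pos by simp
  finally have "card W \<le> A * 2 ^ (d * J)" .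
  moreover have "c\<^sup>2 * (2 powr (real d * real J)) powr (1 - 2 * inv_exp p)
      = C\<^sup>2 * 2 powr (real d * real J * (1 - 2 * inv_exp p)) * 2 powr (- (2 * \<beta>) * real m)"
    unfolding c_def powr_powr by (simp add: power_mult_distrib powr_power algebra_simps)
  ultimately show ?thesis using W_sparse False by (intro that[of W]) (auto simp: geometric_tail_def)
qed

lemma block_ball_sparse_support:
  assumes x_ball: "x \<in> block_ball P p C \<beta>" and p_bounds: "0 < p" "p \<le> 2" and C_pos: "0 < C"
  obtains W where "W \<subseteq> (\<Union>m<n. P m)" "card W \<le> n * (A * 2 ^ (d * J))"
    "(\<lambda>i. x i - (if i \<in> W then x i else 0)) \<in> block_dominated (\<lambda>m.
      geometric_tail (2 * \<beta>) J (C\<^sup>2 * 2 powr (real d * real J * (1 - 2 * inv_exp p))) m +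
      geometric_tail (2 * \<beta>) n (C\<^sup>2) m)"
proof -
  define e where "e = geometric_tail (2 * \<beta>) J (C\<^sup>2 * 2 powr (real d * real J * (1 - 2 * inv_exp p)))"
  define e' where "e' = geometric_tail (2 * \<beta>) n (C\<^sup>2)"
  have e_nonneg: "0 \<le> e m" "0 \<le> e' m" for m by (simp_all add: e_def e'_def geometric_tail_def)
  have "\<exists>W. W \<subseteq> P m \<and> card W \<le> A * 2 ^ (d * J) \<and> (\<Sum>i\<in>P m - W. (x i)\<^sup>2) \<le> e m" for m
    unfolding e_def by (rule block_ball_sparse_block[OF x_ball p_bounds C_pos]) blast
  then obtain V where V_sparse: "\<And>m. V m \<subseteq> P m" "\<And>m. card (V m) \<le> A * 2 ^ (d * J)"
    "\<And>m. (\<Sum>i\<in>P m - V m. (x i)\<^sup>2) \<le> e m" by metis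
  define W where "W = (\<Union>m<n. V m)"
  have "W \<subseteq> (\<Union>m<n. P m)" using V_sparse(1) by (auto simp: W_def)
  moreover have "card W \<le> n * (A * 2 ^ (d * J))"
  proof -
    have "card W \<le> (\<Sum>m<n. card (V m))" unfolding W_def by (rule card_UN_le) simp
    also have "\<dots> \<le> (\<Sum>m<n. A * 2 ^ (d * J))" by (intro sum_mono V_sparse(2))
    finally show ?thesis by simp
  qed
  moreover have "(\<Sum>i\<in>P m. (x i - (if i \<in> W then x i else 0))\<^sup>2) \<le> e m + e' m" for m
  proof -
    have "(\<Sum>i\<in>P m. (x i - (if i \<in> W then x i else 0))\<^sup>2) = (\<Sum>i\<in>P m - W. (x i)\<^sup>2)"
      using finite_block by (intro sum.mono_neutral_cong_right) auto
    also have "\<dots> \<le> e m + e' m"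
    proof (cases "m < n")
      case True
      then have "(\<Sum>i\<in>P m - W. (x i)\<^sup>2) \<le> (\<Sum>i\<in>P m - V m. (x i)\<^sup>2)"
        using finite_block by (intro sum_mono2) (auto simp: W_def)
      then show ?thesis using V_sparse(3)[of m] e_nonneg(2)[of m] by linarith
    next
      case False
      have "(\<Sum>i\<in>P m - W. (x i)\<^sup>2) \<le> (\<Sum>i\<in>P m. (x i)\<^sup>2)"
        using finite_block by (intro sum_mono2) auto
      also have "\<dots> \<le> e' m"
        using x_ball False block_ball_subset_block_dominated_small_exponent[OF p_bounds, of C \<beta>]
        by (auto simp: block_dominated_def e'_def geometric_tail_def)
      finally show ?thesis using e_nonneg(1)[of m] by linarith
    qed
    finally show ?thesis .
  qed
  ultimately show ?thesis by (intro that) (auto simp: block_dominated_def e_def e'_def)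
qed

lemma block_ball_sparse_approximation:
  fixes J K :: nat and C \<beta> :: real
  assumes x_ball: "x \<in> block_ball P p C \<beta>" and p_bounds: "0 < p" "p \<le> 2" and C_pos: "0 < C"
    and \<beta>_pos: "0 < \<beta>"
    and \<sigma>_rate: "\<sigma> = \<beta> - real d * (1/2 - inv_exp p)" "\<sigma> \<le> \<beta> * real K"
  obtains W where "W \<subseteq> (\<Union>m<Suc (K * J). P m)" "card W \<le> Suc (K * J) * (A * 2 ^ (d * J))"
    "l2dist x (\<lambda>i. if i \<in> W then x i else 0) \<le>
      C * sqrt (2 * (\<Sum>m. 2 powr (- (2 * \<beta>) * real m))) * 2 powr (- \<sigma> * real J)"
proof -
  define Z where "Z = (\<Sum>m. 2 powr (- (2 * \<beta>) * real m))"
  define w where "w = C\<^sup>2 * 2 powr (real d * real J * (1 - 2 * inv_exp p))"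
  define n where "n = Suc (K * J)"
  obtain W where W_sparse: "W \<subseteq> (\<Union>m<n. P m)" "card W \<le> n * (A * 2 ^ (d * J))"
    and dominated: "(\<lambda>i. x i - (if i \<in> W then x i else 0)) \<in>
      block_dominated (\<lambda>m. geometric_tail (2 * \<beta>) J w m + geometric_tail (2 * \<beta>) n (C\<^sup>2) m)"
    unfolding w_def by (rule block_ball_sparse_support[OF x_ball p_bounds C_pos])
  have "finite W" using W_sparse(1) finite_block by (auto intro: finite_subset)
  then have W_l2: "(\<lambda>i. if i \<in> W then x i else 0) \<in> l2space" by (rule l2space_restrict)
  have x_l2: "x \<in> l2space"
    using x_ball block_ball_subset_l2space_small_exponent[OF p_bounds \<beta>_pos] by blast
  have tail_sums: "geometric_tail (2 * \<beta>) n w sums (w * 2 powr (- (2 * \<beta>) * real n) * Z)" for n w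
    unfolding Z_def using \<beta>_pos by (intro geometric_tail_sums) simp
  note sums = sums_add[OF tail_sums tail_sums, of J w n "C\<^sup>2"]
  have Z_nonneg: "0 \<le> Z" unfolding Z_def using \<beta>_pos by (intro suminf_two_powr_nonneg) simp
  have "w * 2 powr (- (2 * \<beta>) * real J) = C\<^sup>2 * 2 powr (- (2 * \<sigma>) * real J)"
    unfolding w_def \<sigma>_rate(1) by (simp add: mult.assoc flip: powr_add) (simp add: algebra_simps)
  moreover have "2 powr (- (2 * \<beta>) * real n) \<le> 2 powr (- (2 * \<sigma>) * real J)"
  proof (rule powr_mono)
    have "\<sigma> * real J \<le> \<beta> * real K * real J" using \<sigma>_rate(2) by (intro mult_right_mono) auto
    also have "\<dots> \<le> \<beta> * real n" using \<beta>_pos by (simp add: n_def)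
    finally show "- (2 * \<beta>) * real n \<le> - (2 * \<sigma>) * real J" by simp
  qed simp
  ultimately have "w * 2 powr (- (2 * \<beta>) * real J) * Z + C\<^sup>2 * 2 powr (- (2 * \<beta>) * real n) * Z
      \<le> C\<^sup>2 * 2 powr (- (2 * \<sigma>) * real J) * Z + C\<^sup>2 * 2 powr (- (2 * \<sigma>) * real J) * Z"
    using Z_nonneg by (intro add_mono mult_right_mono mult_left_mono) auto
  also have "\<dots> = (C * sqrt (2 * Z) * 2 powr (- \<sigma> * real J))\<^sup>2"
    using Z_nonneg by (simp add: power_mult_distrib powr_power mult_ac)
  finally have "sqrt (\<Sum>m. geometric_tail (2 * \<beta>) J w m + geometric_tail (2 * \<beta>) n (C\<^sup>2) m)
      \<le> C * sqrt (2 * Z) * 2 powr (- \<sigma> * real J)"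
    using C_pos Z_nonneg sums_unique[OF sums] by (intro real_le_lsqrt) auto
  with l2dist_le_blocks[OF x_l2 W_l2 dominated sums_summable[OF sums]]
  show ?thesis using W_sparse unfolding n_def Z_def by (intro that[of W]) auto
qed

lemma card_initial_blocks_le: "card (\<Union>m<Suc M. P m) \<le> Suc M * (A * 2 ^ (d * M))"
proof -
  have "card (\<Union>m<Suc M. P m) \<le> (\<Sum>m<Suc M. card (P m))" by (rule card_UN_le) simp
  also have "\<dots> \<le> (\<Sum>m<Suc M. A * 2 ^ (d * M))"
  proof (rule sum_mono)
    fix m assume "m \<in> {..<Suc M}"
    then have "A * 2 ^ (d * m) \<le> A * 2 ^ (d * M)"
      by (intro mult_left_mono power_increasing) auto
    then show "card (P m) \<le> A * 2 ^ (d * M)" using card_le[of m] by linarith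
  qed
  finally show ?thesis by simp
qed

definition block_grid :: "nat \<Rightarrow> nat \<Rightarrow> nat \<Rightarrow> nat \<Rightarrow> ('i \<Rightarrow> real) set" where
  "block_grid C H K J = sparse_grid (2 powr (- real (H * J))) (int (C * 2 ^ (H * J)))
     (\<Union>m<Suc (K * J). P m) (Suc (K * J) * (A * 2 ^ (d * J)))"

lemma finite_block_grid: "finite (block_grid C H K J)"
  unfolding block_grid_def using finite_block by (intro finite_sparse_grid) auto

lemma block_grid_subset_l2space: "block_grid C H K J \<subseteq> l2space"
  unfolding block_grid_def using finite_block by (intro sparse_grid_subset_l2space) auto

lemma card_grid_positions_le:
  fixes C H J K :: nat
  assumes C_ge_one: "1 \<le> C"
  defines "g \<equiv> int (C * 2 ^ (H * J))"
  shows "card (\<Union>m<Suc (K * J). P m) * card {- g..g} + 1 \<le> 2 ^ ((K + d * K + H + A + C + 4) * (J + 1))"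
proof -
  define F where "F = (\<Union>m<Suc (K * J). P m)"
  have "card F \<le> Suc (K * J) * (A * 2 ^ (d * (K * J)))"
    unfolding F_def by (rule card_initial_blocks_le)
  also have "\<dots> \<le> 2 ^ Suc (K * J) * (2 ^ A * 2 ^ (d * (K * J)))"
    by (intro mult_mono) (simp_all add: less_imp_le[OF less_exp] del: power_Suc)
  finally have card_F: "card F \<le> 2 ^ (Suc (K * J) + A + d * (K * J))"
    by (simp add: power_add mult.assoc)
  have "card {- g..g} = 2 * (C * 2 ^ (H * J)) + 1"
    by (simp add: g_def nat_add_distrib nat_mult_distrib nat_power_eq)
  also have "\<dots> \<le> 4 * (C * 2 ^ (H * J))" using C_ge_one by simp
  also have "\<dots> \<le> 4 * (2 ^ C * 2 ^ (H * J))"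
    by (intro mult_mono) (simp_all add: less_imp_le[OF less_exp])
  finally have card_g: "card {- g..g} \<le> 2 ^ (C + H * J + 2)" by (simp add: power_add)
  define e where "e = (Suc (K * J) + A + d * (K * J)) + (C + H * J + 2)"
  have "card F * card {- g..g} \<le> 2 ^ (Suc (K * J) + A + d * (K * J)) * 2 ^ (C + H * J + 2)"
    by (intro mult_mono card_F card_g) auto
  then have "card F * card {- g..g} \<le> 2 ^ e" by (simp only: e_def power_add)
  then have "card F * card {- g..g} + 1 \<le> 2 ^ Suc e"
    using one_le_power[of "2::nat" e] by (simp only: power_Suc) linarith
  also have "\<dots> \<le> 2 ^ ((K + d * K + H + A + C + 4) * (J + 1))"
    by (intro power_increasing) (auto simp: e_def algebra_simps)
  finally show ?thesis by (simp only: F_def)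
qed

lemma card_block_grid_le:
  fixes C H J K :: nat
  assumes C_ge_one: "1 \<le> C"
  shows "card (block_grid C H K J)
    \<le> 2 ^ ((K + d * K + H + A + C + 4) * (K + 1) * A * (J + 1)\<^sup>2 * 2 ^ (d * J))"
proof -
  define F where "F = (\<Union>m<Suc (K * J). P m)"
  define g where "g = int (C * 2 ^ (H * J))"
  define k where "k = Suc (K * J) * (A * 2 ^ (d * J))"
  define c where "c = K + d * K + H + A + C + 4"
  have grid: "block_grid C H K J = sparse_grid (2 powr (- real (H * J))) g F k"
    by (simp only: block_grid_def F_def g_def k_def)
  have "finite F" using finite_block by (simp add: F_def)
  then have "card (block_grid C H K J) \<le> (card F * card {- g..g} + 1) ^ k"
    unfolding grid by (rule card_sparse_grid_le)
  also have "\<dots> \<le> (2 ^ (c * (J + 1))) ^ k"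
    unfolding F_def g_def c_def by (intro power_mono card_grid_positions_le C_ge_one) auto
  also have "\<dots> = 2 ^ (c * (J + 1) * k)" by (simp add: power_mult)
  also have "\<dots> \<le> 2 ^ (c * (K + 1) * A * (J + 1)\<^sup>2 * 2 ^ (d * J))"
  proof (intro power_increasing)
    have "c * (J + 1) * k = c * (J + 1) * (A * 2 ^ (d * J)) * Suc (K * J)"
      by (simp only: k_def mult_ac)
    also have "\<dots> \<le> c * (J + 1) * (A * 2 ^ (d * J)) * ((K + 1) * (J + 1))"
      by (intro mult_left_mono) auto
    also have "\<dots> = c * (K + 1) * A * (J + 1)\<^sup>2 * 2 ^ (d * J)"
      by (simp only: power2_eq_square mult_ac)
    finally show "c * (J + 1) * k \<le> c * (K + 1) * A * (J + 1)\<^sup>2 * 2 ^ (d * J)" .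
  qed auto
  finally show ?thesis unfolding c_def .
qed

lemma grid_mesh_mult_sqrt_le:
  fixes H J K N :: nat
  assumes N_le: "N \<le> Suc (K * J) * (A * 2 ^ (d * J))" and H_ge: "2 * \<sigma> + real d + 1 \<le> 2 * real H"
  shows "2 powr (- real (H * J)) * sqrt (real N) \<le> sqrt (real ((K + 1) * A)) * 2 powr (- \<sigma> * real J)"
proof -
  define h where "h = (2::real) powr (- real (H * J))"
  have "N \<le> ((K + 1) * 2 ^ J) * (A * 2 ^ (d * J))"
  proof (rule order_trans[OF N_le], rule mult_right_mono)
    have "K * J \<le> K * 2 ^ J" by (intro mult_left_mono) (simp_all add: less_imp_le[OF less_exp])
    then show "Suc (K * J) \<le> (K + 1) * 2 ^ J"
      using one_le_power[of "2::nat" J] unfolding add_mult_distrib mult_1 by linarith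
  qed simp
  then have "real N \<le> real (((K + 1) * 2 ^ J) * (A * 2 ^ (d * J)))"
    by (simp only: of_nat_le_iff)
  also have "\<dots> = real ((K + 1) * A) * (2 ^ J * 2 ^ (d * J))"
    by (simp only: of_nat_mult of_nat_power of_nat_numeral mult_ac)
  also have "2 ^ J * 2 ^ (d * J) = 2 powr ((real d + 1) * real J)"
    by (simp add: two_power_mult powr_realpow powr_add distrib_right)
  finally have "h\<^sup>2 * real N \<le> h\<^sup>2 * (real ((K + 1) * A) * 2 powr ((real d + 1) * real J))"
    by (intro mult_left_mono) auto
  also have "\<dots> = real ((K + 1) * A) * 2 powr ((real d + 1 - 2 * real H) * real J)"
    by (simp add: h_def powr_power mult.left_commute flip: powr_add) (simp add: algebra_simps)
  also have "\<dots> \<le> real ((K + 1) * A) * 2 powr ((- 2 * \<sigma>) * real J)"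
    using H_ge by (intro mult_left_mono powr_mono mult_right_mono) auto
  finally have "sqrt (h\<^sup>2 * real N) \<le> sqrt (real ((K + 1) * A) * (2 powr (- \<sigma> * real J))\<^sup>2)"
    by (intro real_sqrt_le_mono) (simp add: powr_power mult.commute mult.left_commute)
  then show ?thesis by (simp add: real_sqrt_mult h_def)
qed

lemma block_ball_grid_approximation:
  fixes C H J K :: nat and \<beta> :: real
  assumes x_ball: "x \<in> block_ball P p (real C) \<beta>" and p_bounds: "0 < p" "p \<le> 2"
    and C_ge_one: "1 \<le> C" and \<beta>_pos: "0 < \<beta>"
    and \<sigma>_rate: "\<sigma> = \<beta> - real d * (1/2 - inv_exp p)" "\<sigma> \<le> \<beta> * real K"
    and H_ge: "2 * \<sigma> + real d + 1 \<le> 2 * real H"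
  shows "\<exists>y\<in>block_grid C H K J. l2dist x y \<le>
    (real C * sqrt (2 * (\<Sum>m. 2 powr (- (2 * \<beta>) * real m))) + sqrt (real ((K + 1) * A)))
      * 2 powr (- \<sigma> * real J)"
proof -
  define h where "h = (2::real) powr (- real (H * J))"
  define F where "F = (\<Union>m<Suc (K * J). P m)"
  define k where "k = Suc (K * J) * (A * 2 ^ (d * J))"
  have "0 < real C" using C_ge_one by simp
  then obtain W where W_sparse: "W \<subseteq> F" "card W \<le> k"
    and sparse: "l2dist x (\<lambda>i. if i \<in> W then x i else 0) \<le>
      real C * sqrt (2 * (\<Sum>m. 2 powr (- (2 * \<beta>) * real m))) * 2 powr (- \<sigma> * real J)"
    unfolding F_def k_def
    by (rule block_ball_sparse_approximation[OF x_ball p_bounds _ \<beta>_pos \<sigma>_rate])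
  have finite_F: "finite F" using finite_block by (simp add: F_def)
  have finite_W: "finite W" using W_sparse(1) finite_F by (rule finite_subset)
  let ?x = "\<lambda>i. if i \<in> W then x i else 0"
  let ?y = "\<lambda>i. if i \<in> W then h * of_int \<lfloor>x i / h\<rfloor> else 0"
  have h_pos: "0 < h" by (simp add: h_def)
  have "\<bar>x i\<bar> \<le> h * of_int (int (C * 2 ^ (H * J)))" for i
  proof -
    have "h * 2 ^ (H * J) = 1" by (simp add: h_def powr_minus powr_realpow del: of_nat_mult)
    then have "real C = h * of_int (int (C * 2 ^ (H * J)))" by (simp add: mult.left_commute)
    with block_ball_abs_le[OF x_ball p_bounds(1)] \<beta>_pos show ?thesis
      by (metis less_imp_le of_nat_0_le_iff)
  qed
  then have grid: "?y \<in> sparse_grid h (int (C * 2 ^ (H * J))) F k"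
    using finite_W W_sparse h_pos by (intro floor_in_sparse_grid) auto
  have "h * sqrt (real (card W)) \<le> sqrt (real ((K + 1) * A)) * 2 powr (- \<sigma> * real J)"
    using grid_mesh_mult_sqrt_le[OF W_sparse(2)[unfolded k_def] H_ge] by (simp only: h_def)
  with l2dist_floor_le[OF finite_W h_pos, of x]
  have "l2dist ?x ?y \<le> sqrt (real ((K + 1) * A)) * 2 powr (- \<sigma> * real J)" by linarith
  moreover have "l2dist x ?y \<le> l2dist x ?x + l2dist ?x ?y"
    using x_ball block_ball_subset_l2space_small_exponent[OF p_bounds \<beta>_pos] l2space_restrict[OF finite_W]
    by (intro l2dist_triangle) auto
  ultimately have "l2dist x ?y \<le> (real C * sqrt (2 * (\<Sum>m. 2 powr (- (2 * \<beta>) * real m))) +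
      sqrt (real ((K + 1) * A))) * 2 powr (- \<sigma> * real J)"
    using sparse by (simp add: distrib_right)
  then show ?thesis
    using grid by (intro bexI[of _ ?y]) (simp_all only: block_grid_def h_def F_def k_def)
qed

lemma block_ball_coverable:
  fixes C :: nat
  assumes p_bounds: "0 < p" "p \<le> 2" and C_ge_one: "1 \<le> C" and \<beta>_pos: "0 < \<beta>"
    and \<sigma>_rate: "\<sigma> = \<beta> - real d * (1/2 - inv_exp p)"
  obtains L :: nat and D :: real where "1 \<le> L" "0 \<le> D"
    "\<And>J. l2_coverable (block_ball P p (real C) \<beta>)
      (2 ^ (L * (J + 1)\<^sup>2 * 2 ^ (d * J))) (D * 2 powr (- \<sigma> * real J))"
proof -
  obtain K :: nat where "\<sigma> / \<beta> \<le> real K" using real_arch_simple by blast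
  then have K_ge: "\<sigma> \<le> \<beta> * real K" using \<beta>_pos by (simp add: field_simps)
  obtain H :: nat where "(2 * \<sigma> + real d + 1) / 2 \<le> real H" using real_arch_simple by blast
  then have H_ge: "2 * \<sigma> + real d + 1 \<le> 2 * real H" by simp
  define Z where "Z = (\<Sum>m. 2 powr (- (2 * \<beta>) * real m))"
  have Z_nonneg: "0 \<le> Z" unfolding Z_def using \<beta>_pos by (intro suminf_two_powr_nonneg) simp
  define L where "L = (K + d * K + H + A + C + 4) * (K + 1) * A"
  show ?thesis
  proof
    show "1 \<le> L" using A_pos by (simp add: L_def)
    show "0 \<le> real C * sqrt (2 * Z) + sqrt (real ((K + 1) * A))" using Z_nonneg by simp
    fix J :: nat
    have "card (block_grid C H K J) \<le> 2 ^ (L * (J + 1)\<^sup>2 * 2 ^ (d * J))"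
      unfolding L_def by (rule card_block_grid_le[OF C_ge_one])
    then have "real (card (block_grid C H K J)) \<le> 2 ^ (L * (J + 1)\<^sup>2 * 2 ^ (d * J))" by simp
    then show "l2_coverable (block_ball P p (real C) \<beta>) (2 ^ (L * (J + 1)\<^sup>2 * 2 ^ (d * J)))
        ((real C * sqrt (2 * Z) + sqrt (real ((K + 1) * A))) * 2 powr (- \<sigma> * real J))"
      unfolding l2_coverable_def Z_def
      using finite_block_grid block_grid_subset_l2space
        block_ball_grid_approximation[OF _ p_bounds C_ge_one \<beta>_pos \<sigma>_rate K_ge H_ge]
      by (intro exI[of _ "block_grid C H K J"]) simp
  qed
qed

lemma codec_achieves_block_ball_small_exponent:
  assumes p_bounds: "0 < p" "p \<le> 2" and \<beta>_pos: "0 < \<beta>"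
    and s_bounds: "0 < s" "s < \<beta> / real d - (1/2 - inv_exp p)"
  shows "codec_achieves (block_ball P p C \<beta>) s"
proof -
  define \<sigma> where "\<sigma> = \<beta> - real d * (1/2 - inv_exp p)"
  have s_less: "s < \<sigma> / real d" using s_bounds(2) d_pos by (simp add: \<sigma>_def diff_divide_distrib)
  obtain n where C_le: "C \<le> real n" using real_arch_simple by blast
  define C' where "C' = Suc n"
  have C'_ge: "1 \<le> C'" "C \<le> real C'" using C_le by (simp_all add: C'_def)
  obtain L :: nat and D where L_ge_one: "1 \<le> L" and D_nonneg: "0 \<le> D"
    and cover: "\<And>J. l2_coverable (block_ball P p (real C') \<beta>)
      (2 ^ (L * (J + 1)\<^sup>2 * 2 ^ (d * J))) (D * 2 powr (- \<sigma> * real J))"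
    using block_ball_coverable[OF p_bounds C'_ge(1) \<beta>_pos \<sigma>_def] by blast
  have "codec_achieves (block_ball P p (real C') \<beta>) s"
    by (rule codec_achieves_of_quadratic_coverings[OF d_pos s_bounds(1) s_less L_ge_one D_nonneg _ cover])
      (rule block_ball_subset_l2space_small_exponent[OF p_bounds \<beta>_pos])
  then show ?thesis by (rule codec_achieves_mono[OF block_ball_mono[OF C'_ge(2)]])
qed

lemma codec_achieves_block_ball:
  assumes p_pos: "0 < p" and \<beta>_gt: "real d * max 0 (1/2 - inv_exp p) < \<beta>"
    and s_bounds: "0 < s" "s < \<beta> / real d - (1/2 - inv_exp p)"
  shows "codec_achieves (block_ball P p C \<beta>) s"
proof (cases "p \<le> 2")
  case True
  then have "0 < \<beta>" using \<beta>_gt half_le_inv_exp_iff[OF p_pos] by simp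
  then show ?thesis using p_pos True s_bounds by (intro codec_achieves_block_ball_small_exponent)
next
  case False
  define \<theta> where "\<theta> = 1/2 - inv_exp p"
  have "max 0 (1/2 - inv_exp p) = \<theta>" using False half_le_inv_exp_iff[OF p_pos] by (simp add: \<theta>_def)
  then have "block_ball P p C \<beta> \<subseteq> block_ball P 2 (real A powr \<theta> * C) (\<beta> - real d * \<theta>)"
    and exponent_pos: "0 < \<beta> - real d * \<theta>"
    using block_ball_subset_block_ball_two[OF p_pos, of C \<beta>] \<beta>_gt by simp_all
  moreover have "codec_achieves (block_ball P 2 (real A powr \<theta> * C) (\<beta> - real d * \<theta>)) s"
    using s_bounds d_pos exponent_pos
    by (intro codec_achieves_block_ball_small_exponent) (auto simp: inv_exp_def \<theta>_def field_simps)
  ultimately show ?thesis by (meson codec_achieves_mono)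
qed

end

section \<open>Small balls of random signs\<close>

instance bool :: second_countable_topology
proof
  have "open A" "generate_topology UNIV A" for A :: "bool set"
    by (simp_all add: discrete_topology_class.open_discrete generate_topology.Basis)
  then have "open = generate_topology (UNIV :: bool set set)" by auto
  then show "\<exists>B :: bool set set. countable B \<and> open = generate_topology B"
    by (intro exI[of _ UNIV]) simp
qed

definition signs :: "(nat \<Rightarrow> bool) measure" where
  "signs = (\<Pi>\<^sub>M j\<in>UNIV. measure_pmf (bernoulli_pmf (1/2)))"

lemma sets_signs: "sets signs = sets borel"
proof -
  have "sets signs = sets (\<Pi>\<^sub>M j\<in>(UNIV :: nat set). (borel :: bool measure))"
    unfolding signs_def by (intro sets_PiM_cong) (auto simp: sets_borel_eq_count_space)
  then show ?thesis by (simp add: sets_PiM_equal_borel)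
qed

lemma space_signs [simp]: "space signs = UNIV"
  using sets_eq_imp_space_eq[OF sets_signs] by simp

interpretation signs: product_prob_space "\<lambda>_::nat. measure_pmf (bernoulli_pmf (1/2))" UNIV
  rewrites "(\<Pi>\<^sub>M j\<in>UNIV. measure_pmf (bernoulli_pmf (1/2))) = signs"
  by (simp_all add: signs_def product_prob_spaceI prob_space_measure_pmf)

lemma indep_vars_signs:
  assumes F_finite_nonempty: "finite F" "F \<noteq> {}" and inj_e: "inj_on e F"
  shows "signs.indep_vars (\<lambda>_. measure_pmf (bernoulli_pmf (1/2))) (\<lambda>i \<omega>. \<omega> (e i)) F"
proof (subst signs.indep_vars_iff_distr_eq_PiM'[OF F_finite_nonempty(2)])
  let ?coin = "measure_pmf (bernoulli_pmf (1/2))"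
  show "(\<lambda>\<omega>. \<omega> (e i)) \<in> measurable signs ?coin" for i
    unfolding signs_def by (rule measurable_component_singleton) simp
  have "distr signs (\<Pi>\<^sub>M i\<in>F. ?coin) (\<lambda>\<omega>. \<lambda>i\<in>F. \<omega> (e i)) = (\<Pi>\<^sub>M i\<in>F. ?coin)"
    unfolding signs_def using inj_e by (intro distr_PiM_reindex) (auto simp: prob_space_measure_pmf)
  moreover have "distr signs ?coin (\<lambda>\<omega>. \<omega> (e i)) = ?coin" for i
    using signs.PiM_component[of "e i"] by simp
  ultimately show "distr signs (\<Pi>\<^sub>M i\<in>F. ?coin) (\<lambda>\<omega>. \<lambda>i\<in>F. \<omega> (e i)) =
      (\<Pi>\<^sub>M i\<in>F. distr signs ?coin (\<lambda>\<omega>. \<omega> (e i)))" by simp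
qed

lemma signs_agreement_tail:
  fixes \<eta> :: "'i \<Rightarrow> bool" and e :: "'i \<Rightarrow> nat"
  assumes finite_F: "finite F" and inj_e: "inj_on e F"
  defines "A \<equiv> {\<omega>. (\<Sum>i\<in>F. of_bool (\<omega> (e i) = \<eta> i)) \<le> real (card F) / 4}"
  shows "A \<in> sets signs" "measure signs A \<le> exp (- real (card F) / 8)"
proof -
  let ?coin = "measure_pmf (bernoulli_pmf (1/2))"
  define X where "X i \<omega> = (of_bool (\<omega> (e i) = \<eta> i) :: real)" for i \<omega>
  have coord: "(\<lambda>\<omega>. \<omega> j) \<in> measurable signs ?coin" for j
    unfolding signs_def by (rule measurable_component_singleton) simp
  have [measurable]: "X i \<in> borel_measurable signs" for i
    unfolding X_def[abs_def] by (rule measurable_compose[OF coord]) simp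
  have "{\<omega> \<in> space signs. (\<Sum>i\<in>F. X i \<omega>) \<le> real (card F) / 4} \<in> sets signs" by measurable
  then show "A \<in> sets signs" by (simp add: A_def X_def)
  show "measure signs A \<le> exp (- real (card F) / 8)"
  proof (cases "F = {}")
    case False
    have expectation: "signs.expectation (X i) = 1/2" for i
    proof -
      have "signs.expectation (X i) = (\<integral>v. of_bool (v = \<eta> i) \<partial>distr signs ?coin (\<lambda>\<omega>. \<omega> (e i)))"
        unfolding X_def[abs_def] by (rule integral_distr[OF coord, symmetric]) simp
      also have "distr signs ?coin (\<lambda>\<omega>. \<omega> (e i)) = ?coin"
        using signs.PiM_component[of "e i"] by simp
      finally show ?thesis by (cases "\<eta> i") simp_all
    qed
    interpret Hoeffding_ineq signs F X "\<lambda>_. 0" "\<lambda>_. 1" "real (card F) / 2"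
    proof unfold_locales
      show "signs.indep_vars (\<lambda>_. borel) X F"
        unfolding X_def[abs_def]
        by (rule signs.indep_vars_compose2[OF indep_vars_signs[OF finite_F False inj_e]]) simp
    qed (use finite_F in \<open>simp_all add: X_def[abs_def, symmetric] expectation, simp_all add: X_def\<close>)
    have "measure signs A \<le> exp (- 2 * (real (card F) / 4)\<^sup>2 / (\<Sum>i\<in>F. (1 - 0)\<^sup>2))"
      using Hoeffding_ineq_le[of "real (card F) / 4"] False finite_F
      by (simp add: A_def X_def card_gt_0_iff)
    also have "- 2 * (real (card F) / 4)\<^sup>2 / (\<Sum>i\<in>F. (1 - 0)\<^sup>2) = - real (card F) / 8"
      using finite_F False by (simp add: power2_eq_square)
    finally show ?thesis .
  qed simp
qed

definition random_signs :: "('i \<Rightarrow> real) \<Rightarrow> (nat \<Rightarrow> bool) \<Rightarrow> 'i \<Rightarrow> real" where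
  "random_signs r \<omega> i = (if \<omega> (to_nat_on UNIV i) then r i else - r i)"

definition sign_measure :: "('i \<Rightarrow> real) set \<Rightarrow> ('i \<Rightarrow> real) \<Rightarrow> ('i \<Rightarrow> real) measure" where
  "sign_measure S r = distr signs (restrict_space l2borel S) (random_signs r)"

lemma continuous_on_random_signs: "continuous_on UNIV (random_signs r)"
  unfolding random_signs_def
proof (rule continuous_on_coordinatewise_then_product)
  show "continuous_on UNIV (\<lambda>\<omega>. if \<omega> (to_nat_on UNIV i) then r i else - r i)" for i
    by (rule continuous_on_compose2[OF _ continuous_on_product_coordinates, where t = UNIV
          and g = "\<lambda>b. if b then r i else - r i"]) (simp_all add: continuous_on_discrete)
qed

lemma random_signs_small_ball:
  fixes x r :: "'i \<Rightarrow> real"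
  assumes countable_index: "countable (UNIV :: 'i set)" and finite_F: "finite F"
    and r_ge: "\<And>i. i \<in> F \<Longrightarrow> \<rho> \<le> r i" "0 < \<rho>" and \<epsilon>_le: "\<epsilon>\<^sup>2 \<le> real (card F) / 4 * \<rho>\<^sup>2"
  shows "\<exists>A\<in>sets signs. {\<omega>. (\<Sum>i\<in>F. (x i - random_signs r \<omega> i)\<^sup>2) \<le> \<epsilon>\<^sup>2} \<subseteq> A \<and>
    measure signs A \<le> exp (- real (card F) / 8)"
proof -
  define e where "e = (to_nat_on UNIV :: 'i \<Rightarrow> nat)"
  define A where "A = {\<omega>. (\<Sum>i\<in>F. of_bool (\<omega> (e i) = (x i < 0))) \<le> real (card F) / 4}"
  have inj_e: "inj_on e F" unfolding e_def
    using inj_on_to_nat_on[OF countable_index] by (rule inj_on_subset) simp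
  have "\<omega> \<in> A" if "(\<Sum>i\<in>F. (x i - random_signs r \<omega> i)\<^sup>2) \<le> \<epsilon>\<^sup>2" for \<omega>
  proof -
    have "\<rho>\<^sup>2 * of_bool (\<omega> (e i) = (x i < 0)) \<le> (x i - random_signs r \<omega> i)\<^sup>2" if "i \<in> F" for i
    proof (cases "\<omega> (e i) = (x i < 0)")
      case True
      then have "\<rho> \<le> \<bar>x i - random_signs r \<omega> i\<bar>"
        using r_ge(1)[OF that] r_ge(2) by (auto simp: random_signs_def e_def)
      then have "\<rho>\<^sup>2 \<le> \<bar>x i - random_signs r \<omega> i\<bar>\<^sup>2" using r_ge(2) by (intro power_mono) auto
      then show ?thesis using True by simp
    qed simp
    then have "(\<Sum>i\<in>F. \<rho>\<^sup>2 * of_bool (\<omega> (e i) = (x i < 0))) \<le> (\<Sum>i\<in>F. (x i - random_signs r \<omega> i)\<^sup>2)"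
      by (rule sum_mono)
    also have "\<dots> \<le> real (card F) / 4 * \<rho>\<^sup>2" using that \<epsilon>_le by linarith
    finally have "\<rho>\<^sup>2 * (\<Sum>i\<in>F. of_bool (\<omega> (e i) = (x i < 0))) \<le> \<rho>\<^sup>2 * (real (card F) / 4)"
      by (simp only: sum_distrib_left mult.commute)
    then show ?thesis
      using r_ge(2) by (simp only: A_def mem_Collect_eq mult_le_cancel_left_pos zero_less_power)
  qed
  then show ?thesis
    using signs_agreement_tail[OF finite_F inj_e, of "\<lambda>i. x i < 0"]
    by (intro bexI[of _ A]) (auto simp: A_def)
qed

context finite_blocks
begin

lemma measurable_random_signs:
  assumes summable_c: "summable c" and S_dominated: "S \<subseteq> block_dominated c"
    and range_S: "\<And>\<omega>. random_signs r \<omega> \<in> S"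
  shows "random_signs r \<in> measurable signs (restrict_space l2borel S)"
proof (rule measurable_restrict_space2)
  show "random_signs r \<in> space signs \<rightarrow> S" using range_S by auto
  have "continuous_map euclidean (top_of_set (block_dominated c)) (random_signs r)"
    using range_S S_dominated continuous_on_random_signs
    by (auto simp: continuous_map_in_subtopology)
  from continuous_map_compose[OF this continuous_map_block_dominated[OF summable_c]]
  have "random_signs r \<in> measurable borel l2borel"
    by (intro measurable_l2borel_continuous_map) (simp add: o_def)
  then show "random_signs r \<in> measurable signs l2borel"
    by (simp add: measurable_cong_sets[OF sets_signs refl])
qed

lemma borel_prob_on_sign_measure:
  assumes "summable c" "S \<subseteq> block_dominated c" "\<And>\<omega>. random_signs r \<omega> \<in> S"
  shows "borel_prob_on S (sign_measure S r)"
  using signs.P.prob_space_distr[OF measurable_random_signs[OF assms]] assms(2)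
    block_dominated_subset_l2space[OF assms(1)]
  by (auto simp: borel_prob_on_def sign_measure_def space_restrict_space)

lemma measure_sign_measure_ball_le:
  fixes x r :: "'i \<Rightarrow> real"
  assumes summable_c: "summable c" and S_dominated: "S \<subseteq> block_dominated c"
    and range_S: "\<And>\<omega>. random_signs r \<omega> \<in> S"
    and countable_index: "countable (UNIV :: 'i set)" and finite_F: "finite F"
    and r_ge: "\<And>i. i \<in> F \<Longrightarrow> \<rho> \<le> r i" "0 < \<rho>"
    and x_l2: "x \<in> l2space" and \<epsilon>_bounds: "0 \<le> \<epsilon>" "\<epsilon>\<^sup>2 \<le> real (card F) / 4 * \<rho>\<^sup>2"
  shows "measure (sign_measure S r) (S \<inter> {y\<in>l2space. l2dist x y \<le> \<epsilon>}) \<le> exp (- real (card F) / 8)"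
proof -
  obtain A where A_event: "A \<in> sets signs" "{\<omega>. (\<Sum>i\<in>F. (x i - random_signs r \<omega> i)\<^sup>2) \<le> \<epsilon>\<^sup>2} \<subseteq> A"
    "measure signs A \<le> exp (- real (card F) / 8)"
    using random_signs_small_ball[where r = r and x = x, OF countable_index finite_F r_ge \<epsilon>_bounds(2)]
    by blast
  have "S \<inter> {y\<in>l2space. l2dist x y \<le> \<epsilon>} \<in> sets (restrict_space l2borel S)"
    using closed_ball_sets_l2borel[OF x_l2, of \<epsilon>] by (auto simp: sets_restrict_space)
  then have "measure (sign_measure S r) (S \<inter> {y\<in>l2space. l2dist x y \<le> \<epsilon>})
      = measure signs (random_signs r -` (S \<inter> {y\<in>l2space. l2dist x y \<le> \<epsilon>}) \<inter> space signs)"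
    unfolding sign_measure_def
    by (rule measure_distr[OF measurable_random_signs[OF summable_c S_dominated range_S]])
  also have "\<dots> \<le> measure signs A"
  proof (rule signs.P.finite_measure_mono[OF _ A_event(1)], safe)
    fix \<omega> assume y_near: "l2dist x (random_signs r \<omega>) \<le> \<epsilon>" "random_signs r \<omega> \<in> l2space"
    have "L2_set (\<lambda>i. x i - random_signs r \<omega> i) F \<le> \<epsilon>"
      using L2_set_le_l2dist[OF x_l2 y_near(2) finite_F] y_near(1) by linarith
    then have "(\<Sum>i\<in>F. (x i - random_signs r \<omega> i)\<^sup>2) \<le> \<epsilon>\<^sup>2"
      unfolding L2_set_def by (rule sqrt_le_D)
    then show "\<omega> \<in> A" using A_event(2) by blast
  qed
  also note A_event(3)
  finally show ?thesis .
qed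

end

section \<open>The critical measure\<close>

definition summable_weight :: "nat \<Rightarrow> real" where
  "summable_weight m = 1 / ((real m + 1) * (real m + 2))"

lemma summable_weight_pos: "0 < summable_weight m"
  by (simp add: summable_weight_def add_pos_pos)

lemma sum_summable_weight: "(\<Sum>m<N. summable_weight m) = 1 - 1 / (real N + 1)"
proof (induction N)
  case (Suc N)
  have "summable_weight N = 1 / (real N + 1) - 1 / (real N + 2)"
    by (simp add: summable_weight_def divide_simps)
  then show ?case using Suc by (simp add: add.commute)
qed simp

lemma summable_weight_powr_ge:
  assumes \<delta>_pos: "0 < \<delta>" and \<iota>_nonneg: "0 \<le> \<iota>"
  obtains c where "0 < c" "\<And>m. c * 2 powr (- \<delta> * real m) \<le> summable_weight m powr \<iota>"
proof -
  obtain K where K_bound: "0 < K" "\<And>n::nat. (real n + 1) powr (2 * \<iota>) \<le> K * 2 powr (\<delta> * real n)"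
    using powr_mult_exponential_le[OF \<delta>_pos, of "2 * \<iota>"] by auto
  have "1 / (2 powr \<iota> * K) * 2 powr (- \<delta> * real m) \<le> summable_weight m powr \<iota>" for m
  proof -
    have "(real m + 1) * (real m + 2) \<le> 2 * (real m + 1)\<^sup>2"
      by (simp add: power2_eq_square algebra_simps)
    then have "((real m + 1) * (real m + 2)) powr \<iota> \<le> (2 * (real m + 1)\<^sup>2) powr \<iota>"
      using \<iota>_nonneg by (intro powr_mono2) auto
    also have "\<dots> = 2 powr \<iota> * (real m + 1) powr (2 * \<iota>)"
      by (simp add: powr_mult powr_powr flip: powr_numeral)
    also have "\<dots> \<le> 2 powr \<iota> * (K * 2 powr (\<delta> * real m))" by (intro mult_left_mono K_bound(2)) simp
    finally have "((real m + 1) * (real m + 2)) powr \<iota> \<le> 2 powr \<iota> * K * 2 powr (\<delta> * real m)" by simp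
    then have "1 / (2 powr \<iota> * K * 2 powr (\<delta> * real m)) \<le> 1 / ((real m + 1) * (real m + 2)) powr \<iota>"
      by (intro divide_left_mono) (use K_bound(1) in \<open>auto simp: add_pos_pos intro!: mult_pos_pos\<close>)
    also have "\<dots> = summable_weight m powr \<iota>"
      by (simp only: summable_weight_def powr_divide powr_one_eq_one)
    finally show ?thesis by (simp add: powr_minus divide_inverse)
  qed
  then show ?thesis using K_bound(1) by (intro that[of "1 / (2 powr \<iota> * K)"]) auto
qed

context finite_blocks
begin

definition block_of :: "'i \<Rightarrow> nat" where
  "block_of i = (THE m. i \<in> P m)"

lemma block_of_eq: "i \<in> P m \<Longrightarrow> block_of i = m"
  unfolding block_of_def
  using disjoint_blocks by (intro the_equality) (auto simp: disjoint_family_on_def)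

end

context regular_blocks
begin

definition sign_radius :: "ennreal \<Rightarrow> ennreal \<Rightarrow> real \<Rightarrow> nat \<Rightarrow> real" where
  "sign_radius p q \<alpha> m =
     real (card (P m)) powr (- inv_exp p) * 2 powr (- \<alpha> * real m) * summable_weight m powr inv_exp q"

definition critical_measure :: "ennreal \<Rightarrow> ennreal \<Rightarrow> real \<Rightarrow> ('i \<Rightarrow> real) measure" where
  "critical_measure p q \<alpha> =
     sign_measure (mixed_unit_ball p q \<alpha> P) (\<lambda>i. sign_radius p q \<alpha> (block_of i))"

lemma sign_radius_pos: "0 < sign_radius p q \<alpha> m"
  unfolding sign_radius_def using card_block_pos[of m] summable_weight_pos[of m] by simp

lemma random_signs_in_mixed_unit_ball:
  assumes p_pos: "0 < p" and q_pos: "0 < q"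
  shows "random_signs (\<lambda>i. sign_radius p q \<alpha> (block_of i)) \<omega> \<in> mixed_unit_ball p q \<alpha> P" (is "?x \<in> _")
proof (rule mixed_unit_ballI[OF q_pos])
  show "0 \<le> summable_weight m" for m by (rule less_imp_le[OF summable_weight_pos])
  show "(\<Sum>m<N. summable_weight m) \<le> 1" for N by (simp add: sum_summable_weight)
  show "scaled_norm p \<alpha> P ?x m \<le> summable_weight m powr inv_exp q" for m
  proof -
    have "\<bar>?x i\<bar> \<le> sign_radius p q \<alpha> m" if "i \<in> P m" for i
      using sign_radius_pos[of p q \<alpha> m] by (simp add: random_signs_def block_of_eq[OF that])
    then have "scaled_norm p \<alpha> P ?x m \<le>
        2 powr (\<alpha> * real m) * (real (card (P m)) powr inv_exp p * sign_radius p q \<alpha> m)"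
      unfolding scaled_norm_def using sign_radius_pos[of p q \<alpha> m]
      by (intro mult_left_mono lp_norm_fin_le_of_bounded p_pos finite_block) auto
    also have "\<dots> = (2 powr (\<alpha> * real m) * 2 powr (- \<alpha> * real m)) *
        (real (card (P m)) powr inv_exp p * real (card (P m)) powr (- inv_exp p)) *
        summable_weight m powr inv_exp q"
      by (simp only: sign_radius_def mult_ac)
    also have "\<dots> = summable_weight m powr inv_exp q"
      using card_block_pos[of m] by (simp flip: powr_add)
    finally show ?thesis .
  qed
qed

lemma card_powr_ge:
  obtains c where "0 < c" "\<And>m. c * 2 powr (real d * \<theta> * real m) \<le> real (card (P m)) powr \<theta>"
proof (cases "0 \<le> \<theta>")
  case True
  have "(a * 2 powr (real d * real m)) powr \<theta> \<le> real (card (P m)) powr \<theta>" for m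
    using card_ge[of m] a_pos True by (intro powr_mono2) (auto simp: two_power_mult)
  then show ?thesis
    using a_pos by (intro that[of "a powr \<theta>"]) (auto simp: powr_mult powr_powr mult_ac)
next
  case False
  have "(real A * 2 powr (real d * real m)) powr \<theta> \<le> real (card (P m)) powr \<theta>" for m
    using card_block_le_powr[of m] card_block_pos[of m] False by (intro powr_mono2') auto
  then show ?thesis
    using A_pos by (intro that[of "real A powr \<theta>"]) (auto simp: powr_mult powr_powr mult_ac)
qed

lemma sqrt_card_mult_sign_radius_ge:
  assumes s_gt: "\<alpha> - real d * (1/2 - inv_exp p) < s"
  obtains c where "0 < c"
    "\<And>m. c * 2 powr (- s * real m) \<le> sqrt (real (card (P m))) / 2 * sign_radius p q \<alpha> m"
proof -
  define \<theta> where "\<theta> = 1/2 - inv_exp p"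
  define \<delta> where "\<delta> = s - (\<alpha> - real d * \<theta>)"
  have "0 < \<delta>" using s_gt by (simp add: \<delta>_def \<theta>_def)
  then obtain c1 where weight_ge: "0 < c1"
    "\<And>m. c1 * 2 powr (- \<delta> * real m) \<le> summable_weight m powr inv_exp q"
    using summable_weight_powr_ge inv_exp_nonneg by blast
  obtain c2 where card_ge_c2: "0 < c2"
    "\<And>m. c2 * 2 powr (real d * \<theta> * real m) \<le> real (card (P m)) powr \<theta>"
    using card_powr_ge by blast
  have "c2 * c1 / 2 * 2 powr (- s * real m) \<le> sqrt (real (card (P m))) / 2 * sign_radius p q \<alpha> m" for m
  proof -
    define n where "n = real (card (P m))"
    have n_pos: "0 < n" using card_block_pos by (simp add: n_def)
    have exponent: "- s * real m = real d * \<theta> * real m + - \<delta> * real m + - \<alpha> * real m"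
      by (simp add: \<delta>_def algebra_simps)
    have "c2 * c1 / 2 * 2 powr (- s * real m) = (c2 * 2 powr (real d * \<theta> * real m)) *
        (c1 * 2 powr (- \<delta> * real m)) * 2 powr (- \<alpha> * real m) / 2"
      unfolding exponent powr_add by simp
    also have "\<dots> \<le> n powr \<theta> * summable_weight m powr inv_exp q * 2 powr (- \<alpha> * real m) / 2"
      using weight_ge card_ge_c2
      by (intro divide_right_mono mult_right_mono mult_mono) (auto simp: n_def)
    also have "n powr \<theta> = sqrt n * n powr (- inv_exp p)"
      using n_pos powr_add[of n "1/2" "- inv_exp p"] by (simp add: \<theta>_def powr_half_sqrt)
    also have "sqrt n * n powr (- inv_exp p) * summable_weight m powr inv_exp q * 2 powr (- \<alpha> * real m) / 2
        = sqrt n / 2 * sign_radius p q \<alpha> m"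
      by (simp add: sign_radius_def n_def mult_ac)
    finally show ?thesis by (simp add: n_def)
  qed
  then show ?thesis using weight_ge card_ge_c2 by (intro that[of "c2 * c1 / 2"]) auto
qed

lemma mixed_unit_ball_subset_block_dominated:
  assumes "0 < p" "0 < q" "real d * max 0 (1/2 - inv_exp p) < \<alpha>"
  obtains c where "summable c" "mixed_unit_ball p q \<alpha> P \<subseteq> block_dominated c"
  using block_ball_subset_block_dominated[of p \<alpha> 1] mixed_unit_ball_subset_block_ball[of q p \<alpha>] assms
  by (metis subset_trans)

lemma growth_order_critical_measure:
  assumes p_pos: "0 < p" and q_pos: "0 < q" and \<alpha>_gt: "real d * max 0 (1/2 - inv_exp p) < \<alpha>"
    and countable_index: "countable (UNIV :: 'i set)"
    and s0_rate: "0 \<le> s0" "s0 = \<alpha> / real d - (1/2 - inv_exp p)"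
  shows "growth_order (mixed_unit_ball p q \<alpha> P) (critical_measure p q \<alpha>) s0"
proof (rule growth_order_of_geometric_radii[where b = "2 powr real d" and \<kappa> = "a / 8"
      and \<rho> = "\<lambda>m. sqrt (real (card (P m))) / 2 * sign_radius p q \<alpha> m"])
  obtain c where dominated: "summable c" "mixed_unit_ball p q \<alpha> P \<subseteq> block_dominated c"
    using mixed_unit_ball_subset_block_dominated[OF p_pos q_pos \<alpha>_gt] by blast
  fix x :: "'i \<Rightarrow> real" and \<epsilon> m
  assume x_l2: "x \<in> l2space"
    and \<epsilon>_bounds: "0 \<le> \<epsilon>" "\<epsilon> \<le> sqrt (real (card (P m))) / 2 * sign_radius p q \<alpha> m"
  have "\<epsilon>\<^sup>2 \<le> (sqrt (real (card (P m))) / 2 * sign_radius p q \<alpha> m)\<^sup>2"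
    using \<epsilon>_bounds by (intro power_mono) auto
  then have "\<epsilon>\<^sup>2 \<le> real (card (P m)) / 4 * (sign_radius p q \<alpha> m)\<^sup>2"
    by (simp add: power_mult_distrib power_divide)
  then have "measure (critical_measure p q \<alpha>) (mixed_unit_ball p q \<alpha> P \<inter> {y\<in>l2space. l2dist x y \<le> \<epsilon>})
      \<le> exp (- real (card (P m)) / 8)"
    unfolding critical_measure_def using \<epsilon>_bounds(1) x_l2
    by (intro measure_sign_measure_ball_le[OF dominated random_signs_in_mixed_unit_ball[OF p_pos q_pos]
          countable_index finite_block]) (auto simp: block_of_eq sign_radius_pos)
  also have "\<dots> \<le> exp (- (a / 8) * (2 powr real d) powr real m)"
    using card_ge[of m] by (simp add: two_power_mult powr_powr)
  finally show "measure (critical_measure p q \<alpha>) (mixed_unit_ball p q \<alpha> P \<inter> {y\<in>l2space. l2dist x y \<le> \<epsilon>})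
      \<le> exp (- (a / 8) * (2 powr real d) powr real m)" .
next
  fix s assume "s0 < s"
  then have "\<alpha> - real d * (1/2 - inv_exp p) < real d * s"
    using d_pos by (simp add: s0_rate(2) field_simps)
  from sqrt_card_mult_sign_radius_ge[OF this]
  show "\<exists>c>0. \<forall>m. c * (2 powr real d) powr (- s * real m) \<le>
      sqrt (real (card (P m))) / 2 * sign_radius p q \<alpha> m"
    by (simp add: powr_powr mult.assoc) blast
qed (use d_pos a_pos s0_rate in auto)

end

lemma d_regular_regular_blocks:
  assumes "d_regular d P" "d \<ge> 1"
  obtains a A where "regular_blocks P d a A"
proof -
  obtain a A :: real where a_bound: "0 < a" "\<And>m. finite (P m)" "\<And>m. a * 2 ^ (d * m) \<le> real (card (P m))"
    and A_bound: "\<And>m. real (card (P m)) \<le> A * 2 ^ (d * m)" and partition: "is_partition P"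
    using assms(1) unfolding d_regular_def by metis
  obtain n :: nat where A_le: "A \<le> real n" using real_arch_simple by blast
  have "card (P m) \<le> n * 2 ^ (d * m)" for m
  proof -
    have "real (card (P m)) \<le> real n * 2 ^ (d * m)"
      using A_bound[of m] A_le by (meson mult_right_mono order_trans zero_le_numeral zero_le_power)
    then have "real (card (P m)) \<le> real (n * 2 ^ (d * m))" by simp
    then show ?thesis by (simp only: of_nat_le_iff)
  qed
  then have "regular_blocks P d a n"
    using a_bound partition assms(2) by unfold_locales (auto simp: is_partition_def)
  then show ?thesis by (rule that)
qed

theorem theorem3p3:
  fixes d :: nat and P :: "nat \<Rightarrow> 'i set" and p q :: ennreal and \<alpha> :: real
  assumes "countable (UNIV :: 'i set)" and "infinite (UNIV :: 'i set)"
    and "d \<ge> 1"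
    and "d_regular d P"
    and "p > 0" and "q > 0"
    and "\<alpha> > real d * max 0 (1/2 - inv_exp p)"
  shows "compactin l2top (mixed_unit_ball p q \<alpha> P)
       \<and> mixed_unit_ball p q \<alpha> P \<in> sets l2borel
       \<and> opt_rate (mixed_unit_ball p q \<alpha> P) = ereal (\<alpha> / real d - (1/2 - inv_exp p))
       \<and> (\<exists>M. borel_prob_on (mixed_unit_ball p q \<alpha> P) M \<and> critical (mixed_unit_ball p q \<alpha> P) M)"
proof -
  obtain a A where "regular_blocks P d a A"
    using assms(4,3) by (rule d_regular_regular_blocks)
  then interpret regular_blocks P d a A .
  let ?S = "mixed_unit_ball p q \<alpha> P" and ?M = "critical_measure p q \<alpha>"
  define s0 where "s0 = \<alpha> / real d - (1/2 - inv_exp p)"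
  obtain c where dominated: "summable c" "?S \<subseteq> block_dominated c"
    using assms(5-7) by (rule mixed_unit_ball_subset_block_dominated)
  have compact: "compactin l2top ?S"
    using closed_mixed_unit_ball[OF assms(5,6)] dominated(2,1)
    by (rule compactin_l2top_block_dominated)
  have prob_M: "borel_prob_on ?S ?M"
    unfolding critical_measure_def
    by (rule borel_prob_on_sign_measure[OF dominated random_signs_in_mixed_unit_ball[OF assms(5,6)]])
  have "real d * (1/2 - inv_exp p) < \<alpha>"
    using assms(7) mult_left_mono[of "1/2 - inv_exp p" "max 0 (1/2 - inv_exp p)" "real d"] by simp
  then have "0 < s0" using d_pos by (simp add: s0_def field_simps)
  then have growth: "growth_order ?S ?M s0"
    using assms(5-7,1) s0_def by (intro growth_order_critical_measure) auto
  have codec: "codec_achieves ?S s" if "0 < s" "s < s0" for s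
    using codec_achieves_block_ball[OF assms(5,7)] that
    by (intro codec_achieves_mono[OF mixed_unit_ball_subset_block_ball[OF assms(6)]]) (simp add: s0_def)
  have "opt_rate ?S = ereal s0"
    using prob_M subset_trans[OF dominated(2) block_dominated_subset_l2space[OF dominated(1)]]
      growth \<open>0 < s0\<close> codec
    by (rule opt_rate_eqI)
  then show ?thesis
    using compact compactin_sets_l2borel[OF compact] prob_M growth unfolding critical_def s0_def
    by blast
qed

end
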